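(* Let $N\ge1$, let $e_1,\dots,e_N\in\mathbb{R}$, and let $f_{0\alpha}=f_{0\alpha}(x,v)\ge0$, $\alpha=1,\dots,N$, be $C^1$ and compactly supported on $\mathbb{R}\times\mathbb{R}^2$ and satisfy the neutrality condition $$\iint\sum_\alpha e_\alpha f_{0\alpha}(x,v)\,dv\,dx=0.$$ Let $f_\alpha(t,x,v)$, $\alpha=1,\dots,N$, be the corresponding global solution of the multi-species classical Vlasov-Poisson system with $f_\alpha(0,x,v)=f_{0\alpha}(x,v)$, and define $$Q_1(t)=\sup\Big\{|v_1| : \text{there are } x,v_2\in\mathbb{R}\text{ such that } \sum_\alpha f_\alpha(t,x,v_1,v_2)\ne0\Big\}.$$ Then there is $C>0$ such that for any $t\ge0$, $$Q_1(t)\le C\sqrt{1+t}.$$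
   Context: The multi-species ``one and one-half dimensional'' classical Vlasov-Poisson system, for the unknowns $f_\alpha=f_\alpha(t,x,v)\ge0$ (number density of species $\alpha$ with charge $e_\alpha$), $\alpha=1,\dots,N$, $t\ge0$, $x\in\mathbb{R}$, $v=(v_1,v_2)\in\mathbb{R}^2$, is $$\partial_tf_\alpha+v_1\,\partial_xf_\alpha+e_\alpha E_1\,\partial_{v_1}f_\alpha=0,\qquad \rho(t,x)=\int_{\mathbb{R}^2}\sum_\alpha e_\alpha f_\alpha(t,x,v)\,dv,$$ $$E_1(t,x)=\frac12\left(\int_{-\infty}^x\rho(t,y)\,dy-\int_x^\infty\rho(t,y)\,dy\right).$$ For initial data that are $C^1$, nonnegative and compactly supported, it is known that there is a solution that is $C^1$ for all $t\ge0$, with each $f_\alpha(t,\cdot,\cdot)$ compactly supported for each $t\ge0$; solutions are understood in this sense. The constant $C$ may depend on the data and the charges but not on $t$. If all $f_\alpha$ vanish identically, the supremum of the empty set is taken to be $0$. *)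

theory Defs
  imports "HOL-Analysis.Analysis"
begin

text \<open>
  Densities are functions \<open>f \<alpha> t x v\<close> with species index \<open>\<alpha> \<in> {1..N}\<close>, time \<open>t\<close>,
  position \<open>x\<close> and velocity \<open>v = (v1, v2)\<close>. Only \<open>t \<ge> 0\<close> is meaningful; the values of
  a density at negative times are irrelevant.
\<close>

text \<open>
  On \<open>S = {0..} \<times> UNIV\<close> the derivative at the boundary points \<open>t = 0\<close> is one-sided in \<open>t\<close>.
\<close>

definition C1_on :: "'a::euclidean_space set \<Rightarrow> ('a \<Rightarrow> real) \<Rightarrow> bool" where
  "C1_on S g \<longleftrightarrow>
     (\<exists>g' :: 'a \<Rightarrow> 'a \<Rightarrow>\<^sub>L real.
        (\<forall>z\<in>S. (g has_derivative blinfun_apply (g' z)) (at z within S)) \<and> continuous_on S g')"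

definition compactly_supported :: "('a::euclidean_space \<Rightarrow> real) \<Rightarrow> bool" where
  "compactly_supported g \<longleftrightarrow> compact (closure {z. g z \<noteq> 0})"

definition rho ::
  "nat \<Rightarrow> (nat \<Rightarrow> real) \<Rightarrow> (nat \<Rightarrow> real \<Rightarrow> real \<Rightarrow> real \<times> real \<Rightarrow> real) \<Rightarrow> real \<Rightarrow> real \<Rightarrow> real"
  where "rho N e f t x = (LINT v|lborel. (\<Sum>\<alpha> = 1..N. e \<alpha> * f \<alpha> t x v))"

definition E1 ::
  "nat \<Rightarrow> (nat \<Rightarrow> real) \<Rightarrow> (nat \<Rightarrow> real \<Rightarrow> real \<Rightarrow> real \<times> real \<Rightarrow> real) \<Rightarrow> real \<Rightarrow> real \<Rightarrow> real"
  where "E1 N e f t x =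
    1 / 2 * ((LBINT y:{..x}. rho N e f t y) - (LBINT y:{x..}. rho N e f t y))"

text \<open>
  The time derivative is taken within \<open>{0..}\<close>, hence is one-sided at \<open>t = 0\<close>. All partial
  derivatives in the equation exist by the \<open>C1_on\<close> clause, so \<open>vector_derivative\<close> and
  \<open>deriv\<close> are not used outside their domain.
\<close>

definition vlasov_poisson_solution ::
  "nat \<Rightarrow> (nat \<Rightarrow> real) \<Rightarrow> (nat \<Rightarrow> real \<Rightarrow> real \<times> real \<Rightarrow> real)
     \<Rightarrow> (nat \<Rightarrow> real \<Rightarrow> real \<Rightarrow> real \<times> real \<Rightarrow> real) \<Rightarrow> bool"
  where "vlasov_poisson_solution N e f0 f \<longleftrightarrow>
    (\<forall>\<alpha>\<in>{1..N}.
       C1_on ({0..} \<times> UNIV) (\<lambda>(t, x, v). f \<alpha> t x v) \<and>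
       (\<forall>t\<ge>0. compactly_supported (\<lambda>(x, v). f \<alpha> t x v)) \<and>
       (\<forall>t\<ge>0. \<forall>x v. f \<alpha> t x v \<ge> 0) \<and>
       (\<forall>x v. f \<alpha> 0 x v = f0 \<alpha> x v) \<and>
       (\<forall>t\<ge>0. \<forall>x v1 v2.
          vector_derivative (\<lambda>s. f \<alpha> s x (v1, v2)) (at t within {0..})
          + v1 * deriv (\<lambda>y. f \<alpha> t y (v1, v2)) x
          + e \<alpha> * E1 N e f t x * deriv (\<lambda>w. f \<alpha> t x (w, v2)) v1 = 0))"

definition Q1_set ::
  "nat \<Rightarrow> (nat \<Rightarrow> real \<Rightarrow> real \<Rightarrow> real \<times> real \<Rightarrow> real) \<Rightarrow> real \<Rightarrow> real set"
  where "Q1_set N f t = {\<bar>v1\<bar> | v1. \<exists>x v2. (\<Sum>\<alpha> = 1..N. f \<alpha> t x (v1, v2)) \<noteq> 0}"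

text \<open>
  The supremum of the empty set is 0 by convention; \<open>Sup {}\<close> on the reals is unspecified.
\<close>

definition Q1 ::
  "nat \<Rightarrow> (nat \<Rightarrow> real \<Rightarrow> real \<Rightarrow> real \<times> real \<Rightarrow> real) \<Rightarrow> real \<Rightarrow> real"
  where "Q1 N f t = (if Q1_set N f t = {} then 0 else Sup (Q1_set N f t))"

end

theory Submission
  imports Defs
begin

text \<open>
  Put \<open>U(t, x) = \<integral>\<^bsub>y<x\<^esub> E1(t, y) dy\<close>. Since \<open>\<partial>\<^sub>t E1 = -j\<close>, where \<open>j\<close> is the current,
  conservation of mass and energy bounds \<open>\<partial>\<^sub>t U = -\<integral>\<^bsub>y<x\<^esub> j\<close> uniformly, so \<open>U\<close> grows
  at most linearly in time; neutrality makes the initial field compactly supported, so the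
  energy and \<open>U(0)\<close> are controlled by the data. Along a characteristic \<open>v1\<^sup>2 / 2 - e\<^sub>\<alpha> U\<close>
  changes at the bounded rate \<open>-e\<^sub>\<alpha> \<partial>\<^sub>t U\<close>, whence \<open>v1\<^sup>2 = O(1 + t)\<close>.

  Characteristics are not constructed. That the support stays in a region \<open>h \<le> 0\<close> follows from
  testing the equation with \<open>(max 0 h)\<^sup>2\<close>: the integral of this function against \<open>f\<close> is nonnegative,
  starts at \<open>0\<close> and does not increase.
\<close>

text \<open>Bounding E1 by the total charge gives only \<open>v1 = O(t)\<close>. The gain to the
  square root comes from trading E1 for U, whose time derivative involves the first velocity moment;
  mass and kinetic energy bound that moment uniformly in time. The obstacle is the notion of
  solution: the supports are compact at each time, with no bound that is uniform over a time
  interval, so a priori not even the continuity of E1 in \<open>t\<close> is available. All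
  estimates are therefore made on a time interval over which one box of size \<open>r\<close>
  contains the supports, and the existence of such a box is proved separately. Since
  \<open>r\<close> depends on the solution and on the interval, it must not survive in any final
  estimate; this is why constants are expressed through masses, charges and the support size
  \<open>n\<close> at a single time. Proving that the box exists needs support growth backwards as
  well as forwards in time, which explains the sign \<open>\<sigma>\<close> and the reference time
  \<open>t0\<close> below.\<close>

section \<open>Calculus on boxes and intervals\<close>

lemma integral_cbox_eq_0_of_derivative:
  fixes g g' :: "real \<times> 'b::euclidean_space \<Rightarrow> real"
  assumes "a \<le> b" and cont: "continuous_on (cbox (a, c) (b, d)) g'"
    and deriv: "\<And>x y. x \<in> {a..b} \<Longrightarrow> y \<in> cbox c d \<Longrightarrow>
      ((\<lambda>x. g (x, y)) has_real_derivative g' (x, y)) (at x within {a..b})"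
    and ends: "\<And>y. y \<in> cbox c d \<Longrightarrow> g (a, y) = g (b, y)"
  shows "integral (cbox (a, c) (b, d)) g' = 0"
proof -
  have c2: "continuous_on (cbox (a, c) (b, d)) (\<lambda>(x, y). g' (x, y))"
    using cont by simp
  have "integral (cbox (a, c) (b, d)) g' = integral (cbox a b) (\<lambda>x. integral (cbox c d) (\<lambda>y. g' (x, y)))"
    by (rule integral_prod_continuous[OF cont])
  also have "\<dots> = integral (cbox c d) (\<lambda>y. integral (cbox a b) (\<lambda>x. g' (x, y)))"
    by (rule integral_swap_continuous[OF c2])
  also have "\<dots> = integral (cbox c d) (\<lambda>y. 0)"
  proof (rule integral_cong)
    fix y assume y: "y \<in> cbox c d"
    have "((\<lambda>x. g' (x, y)) has_integral g (b, y) - g (a, y)) {a..b}"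
      using \<open>a \<le> b\<close> deriv[OF _ y]
      by (intro fundamental_theorem_of_calculus)
         (auto simp: has_real_derivative_iff_has_vector_derivative)
    then show "integral (cbox a b) (\<lambda>x. g' (x, y)) = 0"
      using ends[OF y] by (simp add: integral_unique)
  qed
  finally show ?thesis by simp
qed

lemma integral_superset:
  fixes f :: "'a::euclidean_space \<Rightarrow> 'b::banach"
  assumes "S \<subseteq> T" and "\<And>x. x \<in> T - S \<Longrightarrow> f x = 0"
  shows "integral T f = integral S f"
proof -
  have "integral T f = integral T (\<lambda>x. if x \<in> S then f x else 0)"
    using assms(2) by (intro integral_cong) auto
  also have "\<dots> = integral (T \<inter> S) f" by (simp add: integral_restrict_Int Int_commute)
  also have "T \<inter> S = S" using assms(1) by blast
  finally show ?thesis .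
qed

text \<open>Rescaling to \<open>{0..1}\<close> removes the moving endpoint, so that continuity of a
  parametric integral over a fixed set becomes applicable. At \<open>a = x\<close> both sides are
  0.\<close>

lemma integral_Icc_rescale:
  fixes h :: "real \<Rightarrow> real"
  assumes "a \<le> x" and "continuous_on {a..x} h"
  shows "integral {a..x} h = (x - a) * integral {0..1} (\<lambda>s. h (a + s * (x - a)))"
proof (cases "a = x")
  case False
  then have ax: "a < x" using assms by simp
  have "(h has_integral integral {a..x} h) (cbox a x)"
    using assms by (simp add: integrable_continuous_real integrable_integral)
  from has_integral_affinity[OF this, of "x - a" a] ax
  have "((\<lambda>s. h ((x - a) * s + a)) has_integral (1 / (x - a)) * integral {a..x} h)
     ((\<lambda>s. (1 / (x - a)) * s + - ((1 / (x - a)) * a)) ` cbox a x)"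
    by simp
  also have "(\<lambda>s. (1 / (x - a)) * s + - ((1 / (x - a)) * a)) ` cbox a x = {0..1}"
    using ax image_affinity_atLeastAtMost[of "1 / (x - a)" "- ((1 / (x - a)) * a)" a x]
    by (simp flip: diff_divide_distrib)
  finally have "integral {0..1} (\<lambda>s. h ((x - a) * s + a)) = (1 / (x - a)) * integral {a..x} h"
    by (rule integral_unique)
  then show ?thesis using ax by (simp add: ac_simps)
qed simp

lemma continuous_on_integral_upper:
  fixes g :: "'a::topological_space \<Rightarrow> real \<Rightarrow> real"
  assumes "continuous_on (S \<times> {a..b}) (\<lambda>(t, y). g t y)"
  shows "continuous_on (S \<times> {a..b}) (\<lambda>(t, x). integral {a..x} (g t))"
proof -
  have "continuous_on ((S \<times> {a..b}) \<times> cbox 0 (1::real))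
      (\<lambda>(p, s). (\<lambda>(t, y). g t y) (fst p, a + s * (snd p - a)))"
    unfolding case_prod_unfold
  proof (rule continuous_on_compose2[OF assms[unfolded case_prod_unfold]])
    show "continuous_on ((S \<times> {a..b}) \<times> cbox 0 (1::real)) (\<lambda>p. (fst (fst p), a + snd p * (snd (fst p) - a)))"
      by (intro continuous_intros)
    have "a + s * (x - a) \<le> b" if "a \<le> x" "x \<le> b" "0 \<le> s" "s \<le> 1" for x s :: real
      using that mult_left_le_one_le[of "x - a" s] by auto
    then show "(\<lambda>p. (fst (fst p), a + snd p * (snd (fst p) - a))) ` ((S \<times> {a..b}) \<times> cbox 0 1) \<subseteq> S \<times> {a..b}"
      by auto
  qed
  then have "continuous_on ((S \<times> {a..b}) \<times> cbox 0 (1::real))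
      (\<lambda>(p, s). g (fst p) (a + s * (snd p - a)))" by simp
  from integral_continuous_on_param[OF this]
  have "continuous_on (S \<times> {a..b}) (\<lambda>p. (snd p - a) * integral {0..1} (\<lambda>s. g (fst p) (a + s * (snd p - a))))"
    by (auto intro!: continuous_intros)
  moreover have "(\<lambda>(t, x). integral {a..x} (g t)) p
      = (snd p - a) * integral {0..1} (\<lambda>s. g (fst p) (a + s * (snd p - a)))"
    if p: "p \<in> S \<times> {a..b}" for p
  proof -
    obtain t x where [simp]: "p = (t, x)" by fastforce
    have "continuous_on {a..x} (\<lambda>y. (\<lambda>(t, y). g t y) (t, y))"
      by (rule continuous_on_compose2[OF assms]) (use p in \<open>auto intro!: continuous_intros\<close>)
    then show ?thesis using p integral_Icc_rescale[of a x "g t"] by simp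
  qed
  ultimately show ?thesis by (subst continuous_on_cong[OF refl]) assumption+
qed

text \<open>Squaring makes the positive part differentiable at 0 with a continuous derivative, so
  that its composition with \<open>h\<close> is an admissible test function.\<close>

lemma max_0_power2_has_real_derivative:
  fixes x :: real
  shows "((\<lambda>x. (max 0 x)\<^sup>2) has_real_derivative 2 * max 0 x) (at x within S)"
proof -
  have "((\<lambda>x. (max 0 x)\<^sup>2) has_real_derivative 2 * max 0 x) (at x)"
  proof (cases x "0::real" rule: linorder_cases)
    case less
    have "((\<lambda>x. 0) has_real_derivative 0) (at x)" by simp
    then have "((\<lambda>x. (max 0 x)\<^sup>2) has_real_derivative 0) (at x)"
      by (rule DERIV_cong_ev[THEN iffD1, rotated -1, OF _ refl])
         (use less in \<open>auto intro!: eventually_mono[OF eventually_nhds_in_open[of "{..<0}" x]]\<close>)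
    then show ?thesis using less by simp
  next
    case equal
    have "((\<lambda>h::real. (max 0 h)\<^sup>2 / h) \<longlongrightarrow> 0) (at 0)"
      by (rule Lim_null_comparison[where g="\<lambda>h. \<bar>h\<bar>"])
         (auto intro!: always_eventually tendsto_eq_intros simp: max_def power2_eq_square)
    then show ?thesis using equal by (simp add: DERIV_def)
  next
    case greater
    have "((\<lambda>x. x\<^sup>2) has_real_derivative 2 * x) (at x)"
      by (auto intro!: derivative_eq_intros)
    then have "((\<lambda>x. (max 0 x)\<^sup>2) has_real_derivative 2 * x) (at x)"
      by (rule DERIV_cong_ev[THEN iffD1, rotated -1, OF _ refl])
         (use greater in \<open>auto intro!: eventually_mono[OF eventually_nhds_in_open[of "{0<..}" x]]\<close>)
    then show ?thesis using greater by simp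
  qed
  then show ?thesis by (rule has_field_derivative_at_within)
qed

lemma mvt_within:
  fixes g g' :: "real \<Rightarrow> real"
  assumes deriv: "\<And>t. t \<in> {a..b} \<Longrightarrow> (g has_real_derivative g' t) (at t within {a..b})"
    and "a \<le> s" "s \<le> t" "t \<le> b"
  obtains \<xi> where "\<xi> \<in> {s..t}" "g t - g s = g' \<xi> * (t - s)"
proof -
  have "(g has_derivative (*) (g' x)) (at x within {s..t})" if "s \<le> x" "x \<le> t" for x
    using deriv[of x] that assms(2-) unfolding has_field_derivative_def
    by (auto intro: has_derivative_subset)
  from mvt_very_simple[OF \<open>s \<le> t\<close> this] show ?thesis using that by blast
qed

subsection \<open>Transport of one species\<close>

abbreviation phase_box :: "real \<Rightarrow> (real \<times> real \<times> real) set"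
  where "phase_box r \<equiv> cbox (- r, - r, - r) (r, r, r)"

text \<open>A single linear equation: treating the coefficient \<open>A\<close> as given decouples
  the species. Strictness in \<open>supp\<close> makes \<open>f\<close> vanish on the faces of the
  box. \<open>A\<close> is controlled on \<open>{-r..r}\<close> only, because the field put in its
  place is built from integrals over the box.\<close>

locale transport =
  fixes a b r :: real and A :: "real \<Rightarrow> real \<Rightarrow> real"
    and f ft fx fv :: "real \<Rightarrow> real \<times> real \<times> real \<Rightarrow> real"
  assumes ab: "a \<le> b" and r_pos: "0 < r"
    and A_cont: "continuous_on ({a..b} \<times> {-r..r}) (\<lambda>(t, x). A t x)"
    and f_cont: "continuous_on ({a..b} \<times> UNIV) (\<lambda>(t, z). f t z)"
    and ft_cont: "continuous_on ({a..b} \<times> UNIV) (\<lambda>(t, z). ft t z)"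
    and fx_cont: "continuous_on ({a..b} \<times> UNIV) (\<lambda>(t, z). fx t z)"
    and fv_cont: "continuous_on ({a..b} \<times> UNIV) (\<lambda>(t, z). fv t z)"
    and f_t: "t \<in> {a..b} \<Longrightarrow> ((\<lambda>s. f s z) has_real_derivative ft t z) (at t within {a..b})"
    and f_x: "t \<in> {a..b} \<Longrightarrow> ((\<lambda>x. f t (x, v)) has_real_derivative fx t (x, v)) (at x)"
    and f_v: "t \<in> {a..b} \<Longrightarrow> ((\<lambda>v1. f t (x, v1, v2)) has_real_derivative fv t (x, v1, v2)) (at v1)"
    and supp: "t \<in> {a..b} \<Longrightarrow> f t (x, v1, v2) \<noteq> 0 \<Longrightarrow> \<bar>x\<bar> < r \<and> \<bar>v1\<bar> < r \<and> \<bar>v2\<bar> < r"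
    and nonneg: "t \<in> {a..b} \<Longrightarrow> 0 \<le> f t z"
    and pde: "t \<in> {a..b} \<Longrightarrow> \<bar>x\<bar> \<le> r \<Longrightarrow>
      ft t (x, v1, v2) + v1 * fx t (x, v1, v2) + A t x * fv t (x, v1, v2) = 0"
begin

lemma continuous_on_f [continuous_intros]:
  "continuous_on T p \<Longrightarrow> continuous_on T q \<Longrightarrow> (\<And>s. s \<in> T \<Longrightarrow> p s \<in> {a..b}) \<Longrightarrow>
    continuous_on T (\<lambda>s. f (p s) (q s))"
  "continuous_on T p \<Longrightarrow> continuous_on T q \<Longrightarrow> (\<And>s. s \<in> T \<Longrightarrow> p s \<in> {a..b}) \<Longrightarrow>
    continuous_on T (\<lambda>s. ft (p s) (q s))"
  "continuous_on T p \<Longrightarrow> continuous_on T q \<Longrightarrow> (\<And>s. s \<in> T \<Longrightarrow> p s \<in> {a..b}) \<Longrightarrow>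
    continuous_on T (\<lambda>s. fx (p s) (q s))"
  "continuous_on T p \<Longrightarrow> continuous_on T q \<Longrightarrow> (\<And>s. s \<in> T \<Longrightarrow> p s \<in> {a..b}) \<Longrightarrow>
    continuous_on T (\<lambda>s. fv (p s) (q s))"
  for p :: "'z::topological_space \<Rightarrow> real"
  using continuous_on_compose2[OF f_cont, of T "\<lambda>s. (p s, q s)"]
    continuous_on_compose2[OF ft_cont, of T "\<lambda>s. (p s, q s)"]
    continuous_on_compose2[OF fx_cont, of T "\<lambda>s. (p s, q s)"]
    continuous_on_compose2[OF fv_cont, of T "\<lambda>s. (p s, q s)"]
  by (auto simp: image_subset_iff intro!: continuous_on_Pair)

lemma continuous_on_A [continuous_intros]:
  "continuous_on T p \<Longrightarrow> continuous_on T q \<Longrightarrow> (\<And>s. s \<in> T \<Longrightarrow> p s \<in> {a..b}) \<Longrightarrow>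
    (\<And>s. s \<in> T \<Longrightarrow> q s \<in> {-r..r}) \<Longrightarrow> continuous_on T (\<lambda>s. A (p s) (q s))"
  for p :: "'z::topological_space \<Rightarrow> real"
  using continuous_on_compose2[OF A_cont, of T "\<lambda>s. (p s, q s)"]
  by (auto simp: image_subset_iff intro!: continuous_on_Pair)

text \<open>Differentiate under the integral and replace \<open>ft\<close> by means of the equation.
  Since \<open>v1\<close> does not depend on \<open>x\<close>, nor \<open>A t x\<close> on
  \<open>v1\<close>, the transport terms can be moved from \<open>f\<close> to \<open>\<phi>\<close>
  at the cost of two exact derivatives, of \<open>v1 * f * \<phi>\<close> in \<open>x\<close> and of
  \<open>A * f * \<phi>\<close> in \<open>v1\<close>. Their integrals vanish because
  \<open>f\<close> is 0 on the faces.\<close>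

lemma weak_form:
  fixes \<phi> \<phi>t \<phi>x \<phi>v :: "real \<Rightarrow> real \<times> real \<times> real \<Rightarrow> real"
  assumes cont: "continuous_on ({a..b} \<times> phase_box r) (\<lambda>(t, z). \<phi> t z)"
      "continuous_on ({a..b} \<times> phase_box r) (\<lambda>(t, z). \<phi>t t z)"
      "continuous_on ({a..b} \<times> phase_box r) (\<lambda>(t, z). \<phi>x t z)"
      "continuous_on ({a..b} \<times> phase_box r) (\<lambda>(t, z). \<phi>v t z)"
    and \<phi>_t: "\<And>t z. t \<in> {a..b} \<Longrightarrow> z \<in> phase_box r \<Longrightarrow>
      ((\<lambda>s. \<phi> s z) has_real_derivative \<phi>t t z) (at t within {a..b})"
    and \<phi>_x: "\<And>t x v1 v2. t \<in> {a..b} \<Longrightarrow> (x, v1, v2) \<in> phase_box r \<Longrightarrow>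
      ((\<lambda>x. \<phi> t (x, v1, v2)) has_real_derivative \<phi>x t (x, v1, v2)) (at x within {-r..r})"
    and \<phi>_v: "\<And>t x v1 v2. t \<in> {a..b} \<Longrightarrow> (x, v1, v2) \<in> phase_box r \<Longrightarrow>
      ((\<lambda>w. \<phi> t (x, w, v2)) has_real_derivative \<phi>v t (x, v1, v2)) (at v1 within {-r..r})"
    and t: "t \<in> {a..b}"
  shows "((\<lambda>t. integral (phase_box r) (\<lambda>z. f t z * \<phi> t z)) has_real_derivative
      integral (phase_box r) (\<lambda>z. f t z * (\<phi>t t z + fst (snd z) * \<phi>x t z + A t (fst z) * \<phi>v t z)))
      (at t within {a..b})"
proof -
  have [continuous_intros]:
    "continuous_on T p \<Longrightarrow> continuous_on T q \<Longrightarrow> (\<And>s. s \<in> T \<Longrightarrow> p s \<in> {a..b}) \<Longrightarrow>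
     (\<And>s. s \<in> T \<Longrightarrow> q s \<in> phase_box r) \<Longrightarrow> continuous_on T (\<lambda>s. \<phi> (p s) (q s))"
    "continuous_on T p \<Longrightarrow> continuous_on T q \<Longrightarrow> (\<And>s. s \<in> T \<Longrightarrow> p s \<in> {a..b}) \<Longrightarrow>
     (\<And>s. s \<in> T \<Longrightarrow> q s \<in> phase_box r) \<Longrightarrow> continuous_on T (\<lambda>s. \<phi>t (p s) (q s))"
    "continuous_on T p \<Longrightarrow> continuous_on T q \<Longrightarrow> (\<And>s. s \<in> T \<Longrightarrow> p s \<in> {a..b}) \<Longrightarrow>
     (\<And>s. s \<in> T \<Longrightarrow> q s \<in> phase_box r) \<Longrightarrow> continuous_on T (\<lambda>s. \<phi>x (p s) (q s))"
    "continuous_on T p \<Longrightarrow> continuous_on T q \<Longrightarrow> (\<And>s. s \<in> T \<Longrightarrow> p s \<in> {a..b}) \<Longrightarrow>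
     (\<And>s. s \<in> T \<Longrightarrow> q s \<in> phase_box r) \<Longrightarrow> continuous_on T (\<lambda>s. \<phi>v (p s) (q s))"
    for T and p :: "'z::topological_space \<Rightarrow> real" and q
    using cont[THEN continuous_on_compose2, of T "\<lambda>s. (p s, q s)"]
    by (auto simp: image_subset_iff intro!: continuous_on_Pair)
  let ?B = "phase_box r"
  have Bx: "fst z \<in> {-r..r}" if "z \<in> ?B" for z using that by (cases z) auto
  have leib: "((\<lambda>t. integral ?B (\<lambda>z. f t z * \<phi> t z)) has_real_derivative
      integral ?B (\<lambda>z. ft t z * \<phi> t z + f t z * \<phi>t t z)) (at t within {a..b})"
  proof (rule leibniz_rule_field_derivative)
    show "((\<lambda>t. f t z * \<phi> t z) has_real_derivative ft t z * \<phi> t z + f t z * \<phi>t t z) (at t within {a..b})"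
      if "t \<in> {a..b}" "z \<in> ?B" for t z
      using DERIV_mult[OF f_t[OF that(1)] \<phi>_t[OF that], of z] by (simp add: algebra_simps)
    show "(\<lambda>z. f t z * \<phi> t z) integrable_on ?B" if "t \<in> {a..b}" for t
      by (rule integrable_continuous) (use that in \<open>auto intro!: continuous_intros\<close>)
    show "continuous_on ({a..b} \<times> ?B) (\<lambda>(t, z). ft t z * \<phi> t z + f t z * \<phi>t t z)"
      unfolding case_prod_unfold by (intro continuous_intros) auto
  qed (use t in auto)
  have X0: "integral ?B (\<lambda>z. fst (snd z) * (fx t z * \<phi> t z + f t z * \<phi>x t z)) = 0"
  proof (rule integral_cbox_eq_0_of_derivative[where g="\<lambda>z. fst (snd z) * (f t z * \<phi> t z)"])
    show "- r \<le> r" using r_pos by simp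
    show "continuous_on ?B (\<lambda>z. fst (snd z) * (fx t z * \<phi> t z + f t z * \<phi>x t z))"
      using t by (intro continuous_intros) auto
    fix x and v :: "real \<times> real" assume x: "x \<in> {-r..r}" and v: "v \<in> cbox (- r, - r) (r, r)"
    obtain v1 v2 where [simp]: "v = (v1, v2)" by fastforce
    have z: "(x, v1, v2) \<in> ?B" using x v by simp
    show "((\<lambda>x. fst (snd (x, v)) * (f t (x, v) * \<phi> t (x, v))) has_real_derivative
        fst (snd (x, v)) * (fx t (x, v) * \<phi> t (x, v) + f t (x, v) * \<phi>x t (x, v))) (at x within {- r..r})"
      using DERIV_cmult[OF DERIV_mult[OF has_field_derivative_at_within[OF f_x[OF t, of v]] \<phi>_x[OF t z]], of v1]
      by (simp add: algebra_simps)
  next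
    fix v :: "real \<times> real"
    have "f t (r, v) = 0" "f t (-r, v) = 0"
      using supp[OF t, of r "fst v" "snd v"] supp[OF t, of "-r" "fst v" "snd v"] r_pos by auto
    then show "fst (snd (- r, v)) * (f t (- r, v) * \<phi> t (- r, v)) = fst (snd (r, v)) * (f t (r, v) * \<phi> t (r, v))"
      by simp
  qed
  have V0: "integral ?B (\<lambda>z. A t (fst z) * (fv t z * \<phi> t z + f t z * \<phi>v t z)) = 0"
  proof -
    have "integral ?B (\<lambda>z. A t (fst z) * (fv t z * \<phi> t z + f t z * \<phi>v t z)) =
       integral (cbox (-r) r) (\<lambda>x. integral (cbox (-r, -r) (r, r))
         (\<lambda>v. A t (fst (x, v)) * (fv t (x, v) * \<phi> t (x, v) + f t (x, v) * \<phi>v t (x, v))))"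
      using t by (intro integral_prod_continuous continuous_intros Bx) auto
    also have "\<dots> = integral (cbox (-r) r) (\<lambda>x. 0)"
    proof (rule integral_cong)
      fix x assume x: "x \<in> cbox (-r) r"
      show "integral (cbox (-r, -r) (r, r))
         (\<lambda>v. A t (fst (x, v)) * (fv t (x, v) * \<phi> t (x, v) + f t (x, v) * \<phi>v t (x, v))) = 0"
      proof (rule integral_cbox_eq_0_of_derivative[where g="\<lambda>v. A t x * (f t (x, v) * \<phi> t (x, v))"])
        show "- r \<le> r" using r_pos by simp
        show "continuous_on (cbox (-r, -r) (r, r))
          (\<lambda>v. A t (fst (x, v)) * (fv t (x, v) * \<phi> t (x, v) + f t (x, v) * \<phi>v t (x, v)))"
          using t x by (auto intro!: continuous_intros)
        fix v1 v2 assume v: "v1 \<in> {-r..r}" "v2 \<in> cbox (-r) r"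
        have z: "(x, v1, v2) \<in> ?B" using x v by simp
        show "((\<lambda>v1. A t x * (f t (x, v1, v2) * \<phi> t (x, v1, v2))) has_real_derivative
          A t (fst (x, v1, v2)) * (fv t (x, v1, v2) * \<phi> t (x, v1, v2) + f t (x, v1, v2) * \<phi>v t (x, v1, v2)))
          (at v1 within {- r..r})"
          using DERIV_cmult[OF DERIV_mult[OF has_field_derivative_at_within[OF f_v[OF t]] \<phi>_v[OF t z]], of "A t x"]
          by (simp add: algebra_simps)
      next
        fix v2
        have "f t (x, r, v2) = 0" "f t (x, -r, v2) = 0"
          using supp[OF t, of x r v2] supp[OF t, of x "-r" v2] r_pos by auto
        then show "A t x * (f t (x, - r, v2) * \<phi> t (x, - r, v2)) = A t x * (f t (x, r, v2) * \<phi> t (x, r, v2))"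
          by simp
      qed
    qed
    finally show ?thesis by simp
  qed
  let ?G = "\<lambda>z. f t z * (\<phi>t t z + fst (snd z) * \<phi>x t z + A t (fst z) * \<phi>v t z)"
  let ?X = "\<lambda>z. fst (snd z) * (fx t z * \<phi> t z + f t z * \<phi>x t z)"
  let ?V = "\<lambda>z. A t (fst z) * (fv t z * \<phi> t z + f t z * \<phi>v t z)"
  have iG: "?G integrable_on ?B" and iX: "?X integrable_on ?B" and iV: "?V integrable_on ?B"
    using t by (intro integrable_continuous continuous_intros Bx; auto)+
  have "integral ?B (\<lambda>z. ft t z * \<phi> t z + f t z * \<phi>t t z) = integral ?B (\<lambda>z. ?G z - ?X z - ?V z)"
  proof (rule integral_cong)
    fix z assume "z \<in> ?B"
    moreover obtain x v1 v2 where "z = (x, v1, v2)" using prod_cases3 by blast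
    ultimately have "ft t z = - (fst (snd z) * fx t z + A t (fst z) * fv t z)"
      using pde[OF t, of x v1 v2] by (simp add: abs_le_iff)
    then show "ft t z * \<phi> t z + f t z * \<phi>t t z = ?G z - ?X z - ?V z"
      by (simp only:) (simp add: algebra_simps)
  qed
  also have "\<dots> = integral ?B ?G"
    using iG iX iV X0 V0 by (simp add: Henstock_Kurzweil_Integration.integral_diff integrable_diff)
  finally show ?thesis using leib by simp
qed

lemma integral_conserved:
  assumes "t \<in> {a..b}"
  shows "integral (phase_box r) (f t) = integral (phase_box r) (f a)"
proof -
  have "((\<lambda>t. integral (phase_box r) (\<lambda>z. f t z * 1)) has_real_derivative 0) (at t within {a..b})"
    if "t \<in> {a..b}" for t
    using weak_form[of "\<lambda>_ _. 1" "\<lambda>_ _. 0" "\<lambda>_ _. 0" "\<lambda>_ _. 0" t] that by simp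
  from mvt_within[OF this, of a t] assms ab show ?thesis by auto
qed

text \<open>The sign \<open>\<sigma>\<close> lets one argument run forwards from
  \<open>t0 = a\<close> and backwards from \<open>t0 = b\<close>. The derivative of the tested
  integral carries the factor \<open>f * max 0 h\<close>, so \<open>flow\<close> has to be checked
  only where \<open>f\<close> is nonzero and \<open>h\<close> is positive; a support bound already
  obtained can thus serve in deriving the next one. At the end, a continuous nonnegative integrand
  with integral 0 vanishes at every point.\<close>

lemma support_propagation:
  fixes h ht hx hv :: "real \<Rightarrow> real \<times> real \<times> real \<Rightarrow> real"
  assumes cont: "continuous_on ({a..b} \<times> phase_box r) (\<lambda>(t, z). h t z)"
      "continuous_on ({a..b} \<times> phase_box r) (\<lambda>(t, z). ht t z)"
      "continuous_on ({a..b} \<times> phase_box r) (\<lambda>(t, z). hx t z)"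
      "continuous_on ({a..b} \<times> phase_box r) (\<lambda>(t, z). hv t z)"
    and h_t: "\<And>t z. t \<in> {a..b} \<Longrightarrow> z \<in> phase_box r \<Longrightarrow>
      ((\<lambda>s. h s z) has_real_derivative ht t z) (at t within {a..b})"
    and h_x: "\<And>t x v1 v2. t \<in> {a..b} \<Longrightarrow> (x, v1, v2) \<in> phase_box r \<Longrightarrow>
      ((\<lambda>x. h t (x, v1, v2)) has_real_derivative hx t (x, v1, v2)) (at x within {-r..r})"
    and h_v: "\<And>t x v1 v2. t \<in> {a..b} \<Longrightarrow> (x, v1, v2) \<in> phase_box r \<Longrightarrow>
      ((\<lambda>w. h t (x, w, v2)) has_real_derivative hv t (x, v1, v2)) (at v1 within {-r..r})"
    and \<sigma>: "t0 \<in> {a..b}" "\<And>t. t \<in> {a..b} \<Longrightarrow> 0 \<le> \<sigma> * (t - t0)" "\<sigma> \<noteq> 0"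
    and init: "\<And>z. z \<in> phase_box r \<Longrightarrow> 0 < h t0 z \<Longrightarrow> f t0 z = 0"
    and flow: "\<And>t z. t \<in> {a..b} \<Longrightarrow> z \<in> phase_box r \<Longrightarrow> f t z \<noteq> 0 \<Longrightarrow> 0 < h t z \<Longrightarrow>
      \<sigma> * (ht t z + fst (snd z) * hx t z + A t (fst z) * hv t z) \<le> 0"
    and t: "t \<in> {a..b}" and z: "f t z \<noteq> 0"
  shows "h t z \<le> 0"
proof -
  let ?B = "phase_box r" and ?p = "\<lambda>t z. 2 * max 0 (h t z)"
  let ?I = "\<lambda>t. integral ?B (\<lambda>z. f t z * (max 0 (h t z))\<^sup>2)"
  let ?G = "\<lambda>t z. f t z * (?p t z * ht t z + fst (snd z) * (?p t z * hx t z) + A t (fst z) * (?p t z * hv t z))"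
  have [continuous_intros]:
    "continuous_on T p \<Longrightarrow> continuous_on T q \<Longrightarrow> (\<And>s. s \<in> T \<Longrightarrow> p s \<in> {a..b}) \<Longrightarrow>
     (\<And>s. s \<in> T \<Longrightarrow> q s \<in> phase_box r) \<Longrightarrow> continuous_on T (\<lambda>s. h (p s) (q s))"
    "continuous_on T p \<Longrightarrow> continuous_on T q \<Longrightarrow> (\<And>s. s \<in> T \<Longrightarrow> p s \<in> {a..b}) \<Longrightarrow>
     (\<And>s. s \<in> T \<Longrightarrow> q s \<in> phase_box r) \<Longrightarrow> continuous_on T (\<lambda>s. ht (p s) (q s))"
    "continuous_on T p \<Longrightarrow> continuous_on T q \<Longrightarrow> (\<And>s. s \<in> T \<Longrightarrow> p s \<in> {a..b}) \<Longrightarrow>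
     (\<And>s. s \<in> T \<Longrightarrow> q s \<in> phase_box r) \<Longrightarrow> continuous_on T (\<lambda>s. hx (p s) (q s))"
    "continuous_on T p \<Longrightarrow> continuous_on T q \<Longrightarrow> (\<And>s. s \<in> T \<Longrightarrow> p s \<in> {a..b}) \<Longrightarrow>
     (\<And>s. s \<in> T \<Longrightarrow> q s \<in> phase_box r) \<Longrightarrow> continuous_on T (\<lambda>s. hv (p s) (q s))"
    for T and p :: "'z::topological_space \<Rightarrow> real" and q
    using cont[THEN continuous_on_compose2, of T "\<lambda>s. (p s, q s)"]
    by (auto simp: image_subset_iff intro!: continuous_on_Pair)
  have Bx: "fst z \<in> {-r..r}" if "z \<in> ?B" for z using that by (cases z) auto
  have deriv: "(?I has_real_derivative integral ?B (?G t)) (at t within {a..b})" if t: "t \<in> {a..b}" for t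
  proof (rule weak_form[OF _ _ _ _ _ _ _ t])
    show "continuous_on ({a..b} \<times> ?B) (\<lambda>(t, z). (max 0 (h t z))\<^sup>2)"
      "continuous_on ({a..b} \<times> ?B) (\<lambda>(t, z). ?p t z * ht t z)"
      "continuous_on ({a..b} \<times> ?B) (\<lambda>(t, z). ?p t z * hx t z)"
      "continuous_on ({a..b} \<times> ?B) (\<lambda>(t, z). ?p t z * hv t z)"
      unfolding case_prod_unfold by (intro continuous_intros; auto)+
  qed (auto intro!: DERIV_chain2[OF max_0_power2_has_real_derivative] h_t h_x h_v)
  have sgn: "\<sigma> * integral ?B (?G t) \<le> 0" if t: "t \<in> {a..b}" for t
  proof -
    have "0 \<le> integral ?B (\<lambda>z. - \<sigma> * ?G t z)"
    proof (rule Henstock_Kurzweil_Integration.integral_nonneg)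
      show "(\<lambda>z. - \<sigma> * ?G t z) integrable_on ?B"
        using t by (intro integrable_continuous continuous_intros Bx) auto
      fix z assume zB: "z \<in> ?B"
      show "0 \<le> - \<sigma> * ?G t z"
      proof (cases "f t z \<noteq> 0 \<and> 0 < h t z")
        case True
        then have "0 \<le> - (\<sigma> * (ht t z + fst (snd z) * hx t z + A t (fst z) * hv t z))"
          using flow[OF t zB] by simp
        then have "0 \<le> (f t z * ?p t z) * - (\<sigma> * (ht t z + fst (snd z) * hx t z + A t (fst z) * hv t z))"
          using nonneg[OF t] by (intro mult_nonneg_nonneg) auto
        then show ?thesis by (simp add: algebra_simps)
      qed (auto simp: max_def)
    qed
    then show ?thesis by simp
  qed
  have "f t0 z * (max 0 (h t0 z))\<^sup>2 = 0" if "z \<in> ?B" for z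
    using init[OF that] by (auto simp: max_def)
  then have I0: "?I t0 = 0"
    using integral_cong[of ?B "\<lambda>z. f t0 z * (max 0 (h t0 z))\<^sup>2" "\<lambda>_. 0"] by simp
  have It: "?I t \<le> 0"
  proof (cases "t0 \<le> t")
    case True
    obtain \<xi> where \<xi>: "\<xi> \<in> {t0..t}" "?I t - ?I t0 = integral ?B (?G \<xi>) * (t - t0)"
      using mvt_within[OF deriv, of t0 t] True t \<sigma>(1) by auto
    then have "t = t0 \<or> \<sigma> > 0"
      using \<sigma>(2)[OF t] \<sigma>(3) True by (auto simp: zero_le_mult_iff)
    moreover have "integral ?B (?G \<xi>) \<le> 0" if "\<sigma> > 0"
      using sgn[of \<xi>] \<xi>(1) t \<sigma>(1) that by (auto simp: mult_le_0_iff)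
    ultimately show ?thesis
      using \<xi>(2) I0 True by (auto simp: mult_le_0_iff)
  next
    case False
    obtain \<xi> where \<xi>: "\<xi> \<in> {t..t0}" "?I t0 - ?I t = integral ?B (?G \<xi>) * (t0 - t)"
      using mvt_within[OF deriv, of t t0] False t \<sigma>(1) by auto
    have "\<sigma> < 0"
      using \<sigma>(2)[OF t] \<sigma>(3) False by (auto simp: zero_le_mult_iff)
    then have "integral ?B (?G \<xi>) \<ge> 0"
      using sgn[of \<xi>] \<xi>(1) t \<sigma>(1) by (auto simp: mult_le_0_iff)
    then have "0 \<le> integral ?B (?G \<xi>) * (t0 - t)"
      using False by (intro mult_nonneg_nonneg) auto
    then show ?thesis using \<xi>(2) I0 by linarith
  qed
  obtain x v1 v2 where zeq: "z = (x, v1, v2)" using prod_cases3 by blast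
  have zB: "z \<in> ?B" using supp[OF t z[unfolded zeq]] by (auto simp: zeq)
  have c: "continuous_on ?B (\<lambda>z. f t z * (max 0 (h t z))\<^sup>2)"
    using t by (intro continuous_intros) auto
  have nn: "0 \<le> f t z * (max 0 (h t z))\<^sup>2" for z
    using nonneg[OF t] by (intro mult_nonneg_nonneg) auto
  have "?I t = 0"
    by (rule antisym[OF It Henstock_Kurzweil_Integration.integral_nonneg[OF integrable_continuous[OF c] nn]])
  with integrable_integral[OF integrable_continuous[OF c]]
  have "((\<lambda>z. f t z * (max 0 (h t z))\<^sup>2) has_integral 0) ?B" by simp
  then have "f t z * (max 0 (h t z))\<^sup>2 = 0"
    by (rule has_integral_0_cbox_imp_0[OF c nn]) (use zB r_pos in \<open>auto simp: box_eq_empty Basis_prod_def\<close>)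
  then show ?thesis using z by (auto simp: max_def split: if_splits)
qed

text \<open>Under a force of size at most \<open>c\<close> a particle keeps \<open>v2\<close>,
  changes \<open>v1\<close> by at most \<open>c * L\<close>, and hence moves by at most
  \<open>L * (n + c * L)\<close>. The final box adds both increments so that one size serves all
  three coordinates.\<close>

lemma support_growth:
  fixes \<sigma> t0 c L n :: real
  assumes \<sigma>: "\<sigma> = 1 \<and> t0 = a \<or> \<sigma> = -1 \<and> t0 = b"
    and A_le: "\<And>t x. t \<in> {a..b} \<Longrightarrow> \<bar>x\<bar> \<le> r \<Longrightarrow> \<bar>A t x\<bar> \<le> c"
    and init: "\<And>z. f t0 z \<noteq> 0 \<Longrightarrow> z \<in> phase_box n"
    and L: "b - a \<le> L" and "0 \<le> c" "0 \<le> n"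
    and t: "t \<in> {a..b}" and z: "f t z \<noteq> 0"
  shows "z \<in> phase_box (n + c * L + L * (n + c * L))"
proof -
  obtain x v1 v2 where zeq: "z = (x, v1, v2)" using prod_cases3 by blast
  have t0: "t0 \<in> {a..b}" "\<And>t. t \<in> {a..b} \<Longrightarrow> 0 \<le> \<sigma> * (t - t0)" "\<sigma> \<noteq> 0" "\<sigma> * \<sigma> = 1"
    using \<sigma> ab by auto
  have \<sigma>\<sigma>: "\<sigma> * (\<sigma> * y) = y" for y
    using t0(4) by (simp flip: mult.assoc)
  have \<sigma>L: "\<sigma> * (t - t0) \<le> L" if "t \<in> {a..b}" for t
    using \<sigma> L that by auto
  have L0: "0 \<le> L" using L ab by linarith
  have Bx: "\<bar>fst z\<bar> \<le> r" if "z \<in> phase_box r" for z using that by (cases z) auto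
  have init': "\<bar>fst z\<bar> \<le> n" "\<bar>fst (snd z)\<bar> \<le> n" "\<bar>snd (snd z)\<bar> \<le> n" if "f t0 z \<noteq> 0" for z
    using init[OF that] by (cases z; auto)+
  have v2: "\<tau> * v2 - n \<le> 0" if "\<tau> = 1 \<or> \<tau> = -1" for \<tau>
  proof -
    have "(\<lambda>t z. \<tau> * snd (snd z) - n) t z \<le> 0"
    proof (rule support_propagation[where h = "\<lambda>t z. \<tau> * snd (snd z) - n" and ht = "\<lambda>_ _. 0"
          and hx = "\<lambda>_ _. 0" and hv = "\<lambda>_ _. 0", OF _ _ _ _ _ _ _ t0(1-3) _ _ t z])
      fix z :: "real \<times> real \<times> real" assume "0 < \<tau> * snd (snd z) - n"
      then have "\<not> \<bar>snd (snd z)\<bar> \<le> n" using that by auto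
      then show "f t0 z = 0" using init'(3) by blast
    qed (auto intro!: continuous_intros derivative_eq_intros simp: case_prod_unfold)
    then show ?thesis by (simp add: zeq)
  qed
  have v1: "\<tau> * v1 - n - c * (\<sigma> * (t - t0)) \<le> 0"
    if "\<tau> = 1 \<or> \<tau> = -1" "t \<in> {a..b}" "f t (x, v1, v2) \<noteq> 0" for \<tau> t x v1 v2
  proof -
    have "(\<lambda>t z. \<tau> * fst (snd z) - n - c * (\<sigma> * (t - t0))) t (x, v1, v2) \<le> 0"
    proof (rule support_propagation[where h = "\<lambda>t z. \<tau> * fst (snd z) - n - c * (\<sigma> * (t - t0))"
          and ht = "\<lambda>_ _. - c * \<sigma>" and hx = "\<lambda>_ _. 0" and hv = "\<lambda>_ _. \<tau>",
          OF _ _ _ _ _ _ _ t0(1-3) _ _ that(2,3)])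
      fix z :: "real \<times> real \<times> real" assume "0 < \<tau> * fst (snd z) - n - c * (\<sigma> * (t0 - t0))"
      then have "\<not> \<bar>fst (snd z)\<bar> \<le> n" using that by auto
      then show "f t0 z = 0" using init'(2) by blast
    next
      fix t and z :: "real \<times> real \<times> real" assume "t \<in> {a..b}" "z \<in> phase_box r"
      then have "\<bar>A t (fst z)\<bar> \<le> c" using A_le Bx by blast
      then have "\<sigma> * \<tau> * A t (fst z) \<le> c" using that \<sigma> by auto
      then show "\<sigma> * (- c * \<sigma> + fst (snd z) * 0 + A t (fst z) * \<tau>) \<le> 0"
        by (simp add: algebra_simps \<sigma>\<sigma>)
    qed (auto intro!: continuous_intros derivative_eq_intros simp: case_prod_unfold)
    then show ?thesis by simp
  qed
  have v1': "\<bar>fst (snd z)\<bar> \<le> n + c * L" if "t \<in> {a..b}" "f t z \<noteq> 0" for t z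
  proof -
    obtain x v1 v2 where [simp]: "z = (x, v1, v2)" using prod_cases3 by blast
    have "c * (\<sigma> * (t - t0)) \<le> c * L"
      using \<sigma>L[OF that(1)] \<open>0 \<le> c\<close> by (intro mult_left_mono)
    then show ?thesis
      using v1[of 1 t x v1 v2] v1[of "-1" t x v1 v2] that by simp
  qed
  \<comment> \<open>The transport velocity is bounded by \<open>n + c * L\<close> only on the
    support, by \<open>v1'\<close>; on the whole box the bound would be \<open>r\<close>, which must
    not enter the result.\<close>
  have x: "\<tau> * x - n - (n + c * L) * (\<sigma> * (t - t0)) \<le> 0" if "\<tau> = 1 \<or> \<tau> = -1" for \<tau>
  proof -
    have "(\<lambda>t z. \<tau> * fst z - n - (n + c * L) * (\<sigma> * (t - t0))) t z \<le> 0"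
    proof (rule support_propagation[where h = "\<lambda>t z. \<tau> * fst z - n - (n + c * L) * (\<sigma> * (t - t0))"
          and ht = "\<lambda>_ _. - (n + c * L) * \<sigma>" and hx = "\<lambda>_ _. \<tau>" and hv = "\<lambda>_ _. 0",
          OF _ _ _ _ _ _ _ t0(1-3) _ _ t z])
      fix z :: "real \<times> real \<times> real" assume "0 < \<tau> * fst z - n - (n + c * L) * (\<sigma> * (t0 - t0))"
      then have "\<not> \<bar>fst z\<bar> \<le> n" using that by auto
      then show "f t0 z = 0" using init'(1) by blast
    next
      fix t and z :: "real \<times> real \<times> real" assume "t \<in> {a..b}" "f t z \<noteq> 0"
      then have "\<sigma> * \<tau> * fst (snd z) \<le> n + c * L" using v1'[of t z] that \<sigma> by auto
      then show "\<sigma> * (- (n + c * L) * \<sigma> + fst (snd z) * \<tau> + A t (fst z) * 0) \<le> 0"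
        by (simp add: algebra_simps \<sigma>\<sigma>)
    qed (auto intro!: continuous_intros derivative_eq_intros simp: case_prod_unfold algebra_simps)
    then show ?thesis by (simp add: zeq)
  qed
  have w: "0 \<le> n + c * L" "0 \<le> c * L" "0 \<le> L * (n + c * L)"
    using \<open>0 \<le> c\<close> \<open>0 \<le> n\<close> L0 by auto
  have "(n + c * L) * (\<sigma> * (t - t0)) \<le> L * (n + c * L)"
    using \<sigma>L[OF t] w(1) by (subst mult.commute) (intro mult_right_mono)
  then have "\<bar>x\<bar> \<le> n + L * (n + c * L)"
    using x[of 1] x[of "-1"] by simp
  moreover have "\<bar>v1\<bar> \<le> n + c * L" using v1'[OF t z] by (simp add: zeq)
  moreover have "\<bar>v2\<bar> \<le> n" using v2[of 1] v2[of "-1"] by simp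
  ultimately show ?thesis
    using w by (auto simp: zeq abs_le_iff)
qed

end

subsection \<open>The system with uniformly bounded supports\<close>

text \<open>Stand-ins for \<open>rho\<close> and \<open>E1\<close> over a fixed box. They agree with
  the originals as long as the supports lie in the box, and over a compact box joint continuity and
  differentiation under the integral follow from continuity of the integrand.\<close>

definition box_charge ::
  "nat \<Rightarrow> (nat \<Rightarrow> real) \<Rightarrow> real \<Rightarrow> (nat \<Rightarrow> real \<Rightarrow> real \<times> real \<times> real \<Rightarrow> real) \<Rightarrow> real \<Rightarrow> real \<Rightarrow> real"
  where "box_charge N e r g t x = integral (cbox (- r, - r) (r, r)) (\<lambda>v. \<Sum>\<alpha> = 1..N. e \<alpha> * g \<alpha> t (x, v))"

definition box_field ::
  "nat \<Rightarrow> (nat \<Rightarrow> real) \<Rightarrow> real \<Rightarrow> (nat \<Rightarrow> real \<Rightarrow> real \<times> real \<times> real \<Rightarrow> real) \<Rightarrow> real \<Rightarrow> real \<Rightarrow> real"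
  where "box_field N e r g t x =
    1 / 2 * (integral {- r..x} (box_charge N e r g t) - integral {x..r} (box_charge N e r g t))"

locale vlasov_poisson_box =
  fixes N :: nat and e :: "nat \<Rightarrow> real" and a b r :: real
    and g gt gx gv :: "nat \<Rightarrow> real \<Rightarrow> real \<times> real \<times> real \<Rightarrow> real"
  assumes ab: "a \<le> b" and r_pos: "0 < r"
    and g_cont: "\<alpha> \<in> {1..N} \<Longrightarrow> continuous_on ({a..b} \<times> UNIV) (\<lambda>(t, z). g \<alpha> t z)"
    and gt_cont: "\<alpha> \<in> {1..N} \<Longrightarrow> continuous_on ({a..b} \<times> UNIV) (\<lambda>(t, z). gt \<alpha> t z)"
    and gx_cont: "\<alpha> \<in> {1..N} \<Longrightarrow> continuous_on ({a..b} \<times> UNIV) (\<lambda>(t, z). gx \<alpha> t z)"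
    and gv_cont: "\<alpha> \<in> {1..N} \<Longrightarrow> continuous_on ({a..b} \<times> UNIV) (\<lambda>(t, z). gv \<alpha> t z)"
    and g_t: "\<alpha> \<in> {1..N} \<Longrightarrow> t \<in> {a..b} \<Longrightarrow>
      ((\<lambda>s. g \<alpha> s z) has_real_derivative gt \<alpha> t z) (at t within {a..b})"
    and g_x: "\<alpha> \<in> {1..N} \<Longrightarrow> t \<in> {a..b} \<Longrightarrow>
      ((\<lambda>x. g \<alpha> t (x, v)) has_real_derivative gx \<alpha> t (x, v)) (at x)"
    and g_v: "\<alpha> \<in> {1..N} \<Longrightarrow> t \<in> {a..b} \<Longrightarrow>
      ((\<lambda>v1. g \<alpha> t (x, v1, v2)) has_real_derivative gv \<alpha> t (x, v1, v2)) (at v1)"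
    and supp: "\<alpha> \<in> {1..N} \<Longrightarrow> t \<in> {a..b} \<Longrightarrow> g \<alpha> t (x, v1, v2) \<noteq> 0 \<Longrightarrow>
      \<bar>x\<bar> < r \<and> \<bar>v1\<bar> < r \<and> \<bar>v2\<bar> < r"
    and nonneg: "\<alpha> \<in> {1..N} \<Longrightarrow> t \<in> {a..b} \<Longrightarrow> 0 \<le> g \<alpha> t z"
    and pde: "\<alpha> \<in> {1..N} \<Longrightarrow> t \<in> {a..b} \<Longrightarrow> \<bar>x\<bar> \<le> r \<Longrightarrow>
      gt \<alpha> t (x, v1, v2) + v1 * gx \<alpha> t (x, v1, v2)
      + e \<alpha> * box_field N e r g t x * gv \<alpha> t (x, v1, v2) = 0"
begin

abbreviation "charge \<equiv> box_charge N e r g"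
abbreviation "field \<equiv> box_field N e r g"

section \<open>Continuity of charge and field; reduction to single species\<close>

lemma continuous_on_g:
  fixes p :: "'z::topological_space \<Rightarrow> real"
  assumes "\<alpha> \<in> {1..N}" "continuous_on T p" "continuous_on T q" "\<And>s. s \<in> T \<Longrightarrow> p s \<in> {a..b}"
  shows "continuous_on T (\<lambda>s. g \<alpha> (p s) (q s))" "continuous_on T (\<lambda>s. gt \<alpha> (p s) (q s))"
    "continuous_on T (\<lambda>s. gx \<alpha> (p s) (q s))" "continuous_on T (\<lambda>s. gv \<alpha> (p s) (q s))"
  using g_cont[OF assms(1), THEN continuous_on_compose2, of T "\<lambda>s. (p s, q s)"]
    gt_cont[OF assms(1), THEN continuous_on_compose2, of T "\<lambda>s. (p s, q s)"]
    gx_cont[OF assms(1), THEN continuous_on_compose2, of T "\<lambda>s. (p s, q s)"]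
    gv_cont[OF assms(1), THEN continuous_on_compose2, of T "\<lambda>s. (p s, q s)"] assms(2-)
  by (auto simp: image_subset_iff intro!: continuous_on_Pair)

lemma continuous_on_charge_gen: "continuous_on ({a..b} \<times> UNIV) (\<lambda>(t, x). charge t x)"
proof -
  have "continuous_on (({a..b} \<times> UNIV) \<times> cbox (- r, - r) (r, r))
     (\<lambda>(p, v). \<Sum>\<alpha> = 1..N. e \<alpha> * g \<alpha> (fst p) (snd p, v))"
    unfolding case_prod_unfold by (intro continuous_intros continuous_on_g) auto
  from integral_continuous_on_param[OF this] show ?thesis
    by (simp add: box_charge_def case_prod_unfold)
qed

lemma continuous_on_charge:
  "continuous_on T p \<Longrightarrow> continuous_on T q \<Longrightarrow> (\<And>s. s \<in> T \<Longrightarrow> p s \<in> {a..b}) \<Longrightarrow>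
    continuous_on T (\<lambda>s. charge (p s) (q s))"
  for p :: "'z::topological_space \<Rightarrow> real"
  using continuous_on_compose2[OF continuous_on_charge_gen, of T "\<lambda>s. (p s, q s)"]
  by (auto simp: image_subset_iff intro!: continuous_on_Pair)

lemma charge_integrable: "t \<in> {a..b} \<Longrightarrow> charge t integrable_on {c..d}"
  by (intro integrable_continuous_real continuous_on_charge continuous_intros) auto

text \<open>Leaves only one integral with a moving endpoint, so that continuity and the time
  derivative of the field both reduce to \<open>integral {-r..x} (charge t)\<close>.\<close>

lemma field_eq:
  assumes "t \<in> {a..b}" "x \<in> {-r..r}"
  shows "field t x = integral {-r..x} (charge t) - 1 / 2 * integral {-r..r} (charge t)"
  using Henstock_Kurzweil_Integration.integral_combine[of "-r" x r "charge t"] charge_integrable[OF assms(1)] assms(2)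
  by (simp add: box_field_def)

lemma continuous_on_field_gen: "continuous_on ({a..b} \<times> {-r..r}) (\<lambda>(t, x). field t x)"
proof -
  have 1: "continuous_on ({a..b} \<times> {-r..r}) (\<lambda>(t, x). integral {-r..x} (charge t))"
    by (intro continuous_on_integral_upper continuous_on_subset[OF continuous_on_charge_gen]) auto
  have "continuous_on ({a..b} \<times> {-r..r}) (\<lambda>p. (\<lambda>(t, x). integral {-r..x} (charge t)) (fst p, r))"
    by (rule continuous_on_compose2[OF 1]) (use r_pos in \<open>auto intro!: continuous_intros\<close>)
  then have 2: "continuous_on ({a..b} \<times> {-r..r}) (\<lambda>p. integral {-r..r} (charge (fst p)))"
    by simp
  show ?thesis
    using continuous_on_diff[OF 1 continuous_on_mult_left[OF 2, of "1/2"]]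
    by (rule continuous_on_cong[THEN iffD1, rotated 2]) (auto simp: field_eq)
qed

lemma continuous_on_field:
  "continuous_on T p \<Longrightarrow> continuous_on T q \<Longrightarrow> (\<And>s. s \<in> T \<Longrightarrow> p s \<in> {a..b}) \<Longrightarrow>
    (\<And>s. s \<in> T \<Longrightarrow> q s \<in> {-r..r}) \<Longrightarrow> continuous_on T (\<lambda>s. field (p s) (q s))"
  for p :: "'z::topological_space \<Rightarrow> real"
  using continuous_on_compose2[OF continuous_on_field_gen, of T "\<lambda>s. (p s, q s)"]
  by (auto simp: image_subset_iff intro!: continuous_on_Pair)

lemma transport_species:
  assumes "\<alpha> \<in> {1..N}"
  shows "transport a b r (\<lambda>t x. e \<alpha> * field t x) (g \<alpha>) (gt \<alpha>) (gx \<alpha>) (gv \<alpha>)"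
proof
  show "continuous_on ({a..b} \<times> {- r..r}) (\<lambda>(t, x). e \<alpha> * field t x)"
    using continuous_on_mult_left[OF continuous_on_field_gen, of "e \<alpha>"] by (simp add: case_prod_unfold)
qed (use ab r_pos g_cont gt_cont gx_cont gv_cont g_t g_x g_v supp nonneg pde assms in auto)

section \<open>Conserved masses, field bound and support growth\<close>

definition mass :: "nat \<Rightarrow> real \<Rightarrow> real" where "mass \<alpha> t = integral (phase_box r) (g \<alpha> t)"

text \<open>Absolute values prevent cancellation between species of opposite sign; in this form the
  charge dominates the field at every point and is conserved along with the masses.\<close>

definition total_charge :: "real \<Rightarrow> real" where "total_charge t = (\<Sum>\<alpha> = 1..N. \<bar>e \<alpha>\<bar> * mass \<alpha> t)"

lemma g_integrable:
  assumes "\<alpha> \<in> {1..N}" "t \<in> {a..b}"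
  shows "g \<alpha> t integrable_on phase_box r"
  using assms by (intro integrable_continuous continuous_on_g continuous_intros) auto

lemma mass_nonneg: "\<alpha> \<in> {1..N} \<Longrightarrow> t \<in> {a..b} \<Longrightarrow> 0 \<le> mass \<alpha> t"
  unfolding mass_def by (intro Henstock_Kurzweil_Integration.integral_nonneg g_integrable nonneg)

lemma mass_conserved: "\<alpha> \<in> {1..N} \<Longrightarrow> t \<in> {a..b} \<Longrightarrow> mass \<alpha> t = mass \<alpha> a"
  unfolding mass_def by (rule transport.integral_conserved[OF transport_species])

lemma total_charge_conserved: "t \<in> {a..b} \<Longrightarrow> total_charge t = total_charge a"
  unfolding total_charge_def by (intro sum.cong) (auto simp: mass_conserved[of _ t])

lemma total_charge_nonneg: "t \<in> {a..b} \<Longrightarrow> 0 \<le> total_charge t"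
  unfolding total_charge_def by (intro sum_nonneg mult_nonneg_nonneg mass_nonneg) auto

text \<open>One estimate for two uses: the weight 1 gives the bound on the field, the weight
  \<open>fst\<close> the bound on the integrated current.\<close>

lemma abs_integral_moment_le:
  assumes t: "t \<in> {a..b}" and w: "continuous_on UNIV w" and x: "- r \<le> c" "d \<le> r"
  shows "integral {c..d} (\<lambda>x. \<bar>integral (cbox (- r, - r) (r, r)) (\<lambda>v. \<Sum>\<alpha> = 1..N. e \<alpha> * (w v * g \<alpha> t (x, v)))\<bar>)
    \<le> (\<Sum>\<alpha> = 1..N. \<bar>e \<alpha>\<bar> * integral (phase_box r) (\<lambda>z. \<bar>w (snd z)\<bar> * g \<alpha> t z))"
proof -
  have [continuous_intros]: "continuous_on S q \<Longrightarrow> continuous_on S (\<lambda>s. w (q s))"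
    for S :: "'z::topological_space set" and q
    using continuous_on_compose2[OF w] by auto
  let ?V = "cbox (- r, - r) (r, r :: real)"
  let ?m = "\<lambda>x. integral ?V (\<lambda>v. \<Sum>\<alpha> = 1..N. e \<alpha> * (w v * g \<alpha> t (x, v)))"
  let ?M = "\<lambda>x. integral ?V (\<lambda>v. \<Sum>\<alpha> = 1..N. \<bar>e \<alpha>\<bar> * (\<bar>w v\<bar> * g \<alpha> t (x, v)))"
  have cm: "continuous_on S ?m" "continuous_on S ?M" for S
    by (intro integral_continuous_on_param, unfold case_prod_unfold,
        intro continuous_intros continuous_on_g, use t in auto)+
  have le: "\<bar>?m x\<bar> \<le> ?M x" for x
  proof (subst real_norm_def[symmetric], rule integral_norm_bound_integral)
    fix v
    show "norm (\<Sum>\<alpha> = 1..N. e \<alpha> * (w v * g \<alpha> t (x, v))) \<le> (\<Sum>\<alpha> = 1..N. \<bar>e \<alpha>\<bar> * (\<bar>w v\<bar> * g \<alpha> t (x, v)))"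
      by (rule order_trans[OF norm_sum]) (use nonneg t in \<open>auto simp: abs_mult\<close>)
  qed (intro integrable_continuous continuous_intros continuous_on_g, use t in auto)+
  have M0: "0 \<le> ?M x" for x using le[of x] by linarith
  have "integral {c..d} (\<lambda>x. \<bar>?m x\<bar>) \<le> integral {c..d} ?M"
    by (intro integral_le integrable_continuous_real continuous_intros cm le)
  also have "\<dots> \<le> integral {-r..r} ?M"
    using x M0 by (intro integral_subset_le integrable_continuous_real cm) auto
  also have "\<dots> = integral (phase_box r) (\<lambda>z. \<Sum>\<alpha> = 1..N. \<bar>e \<alpha>\<bar> * (\<bar>w (snd z)\<bar> * g \<alpha> t z))"
    using t by (subst integral_prod_continuous) (auto intro!: continuous_intros continuous_on_g)
  also have "\<dots> = (\<Sum>\<alpha> = 1..N. \<bar>e \<alpha>\<bar> * integral (phase_box r) (\<lambda>z. \<bar>w (snd z)\<bar> * g \<alpha> t z))"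
    using t by (subst integral_sum) (auto intro!: integrable_continuous continuous_intros continuous_on_g)
  finally show ?thesis .
qed

lemma abs_field_le:
  assumes t: "t \<in> {a..b}" and x: "x \<in> {-r..r}"
  shows "\<bar>field t x\<bar> \<le> total_charge t"
proof -
  have eq: "(\<lambda>x. \<bar>charge t x\<bar>) = (\<lambda>x. \<bar>integral (cbox (- r, - r) (r, r)) (\<lambda>v. \<Sum>\<alpha> = 1..N. e \<alpha> * (1 * g \<alpha> t (x, v)))\<bar>)"
    by (simp add: box_charge_def)
  have 1: "\<bar>integral {c..d} (charge t)\<bar> \<le> total_charge t" if "-r \<le> c" "d \<le> r" for c d
  proof -
    have "\<bar>integral {c..d} (charge t)\<bar> \<le> integral {c..d} (\<lambda>x. \<bar>charge t x\<bar>)"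
      using t by (subst real_norm_def[symmetric], intro integral_norm_bound_integral charge_integrable
        integrable_continuous_real continuous_intros continuous_on_charge) auto
    also have "\<dots> \<le> total_charge t"
      unfolding eq using abs_integral_moment_le[OF t continuous_on_const[of _ 1] that] t nonneg
      by (simp add: total_charge_def mass_def cong: integral_cong)
    finally show ?thesis .
  qed
  show ?thesis
    using 1[of "-r" x] 1[of x r] x by (simp add: box_field_def)
qed

text \<open>Conservation lets the charge at \<open>t0\<close> alone bound the field on the whole
  interval. The growth rate therefore does not depend on \<open>r\<close>, even though
  \<open>r\<close> is what makes the computation legitimate.\<close>

lemma support_growth:
  assumes \<alpha>: "\<alpha> \<in> {1..N}" and t0: "t0 = a \<or> t0 = b"
    and init: "\<And>z. g \<alpha> t0 z \<noteq> 0 \<Longrightarrow> z \<in> phase_box n"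
    and L: "b - a \<le> L" and c: "\<bar>e \<alpha>\<bar> * total_charge t0 \<le> c" and "0 \<le> n"
    and t: "t \<in> {a..b}" and z: "g \<alpha> t z \<noteq> 0"
  shows "z \<in> phase_box (n + c * L + L * (n + c * L))"
proof -
  interpret transport a b r "\<lambda>t x. e \<alpha> * field t x" "g \<alpha>" "gt \<alpha>" "gx \<alpha>" "gv \<alpha>"
    by (rule transport_species[OF \<alpha>])
  have t0ab: "t0 \<in> {a..b}" using t0 ab by auto
  have c0: "0 \<le> c" using c total_charge_nonneg[OF t0ab] by (smt (verit) abs_ge_zero mult_nonneg_nonneg)
  have Ale: "\<bar>e \<alpha> * field t x\<bar> \<le> c" if "t \<in> {a..b}" "\<bar>x\<bar> \<le> r" for t x
  proof -
    have "\<bar>field t x\<bar> \<le> total_charge t0"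
      using abs_field_le[OF that(1), of x] that total_charge_conserved[OF that(1)] total_charge_conserved[OF t0ab]
      by (auto simp: abs_le_iff)
    then have "\<bar>e \<alpha>\<bar> * \<bar>field t x\<bar> \<le> \<bar>e \<alpha>\<bar> * total_charge t0" by (intro mult_left_mono) auto
    then show ?thesis using c by (simp add: abs_mult)
  qed
  from t0 show ?thesis
  proof
    assume "t0 = a"
    then show ?thesis using support_growth[of 1 t0 c n L t z] Ale init L c0 \<open>0 \<le> n\<close> t z by auto
  next
    assume "t0 = b"
    then show ?thesis using support_growth[of "-1" t0 c n L t z] Ale init L c0 \<open>0 \<le> n\<close> t z by auto
  qed
qed

subsection \<open>Energy, potential and growth of velocities\<close>

definition current :: "real \<Rightarrow> real \<Rightarrow> real" where
  "current t x = integral (cbox (- r, - r) (r, r)) (\<lambda>v. \<Sum>\<alpha> = 1..N. e \<alpha> * (fst v * g \<alpha> t (x, v)))"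

lemma continuous_on_current_gen: "continuous_on ({a..b} \<times> UNIV) (\<lambda>(t, x). current t x)"
proof -
  have "continuous_on (({a..b} \<times> UNIV) \<times> cbox (- r, - r) (r, r))
     (\<lambda>(p, v). \<Sum>\<alpha> = 1..N. e \<alpha> * (fst v * g \<alpha> (fst p) (snd p, v)))"
    unfolding case_prod_unfold by (intro continuous_intros continuous_on_g) auto
  from integral_continuous_on_param[OF this] show ?thesis
    by (simp add: current_def case_prod_unfold)
qed

lemma continuous_on_current:
  "continuous_on T p \<Longrightarrow> continuous_on T q \<Longrightarrow> (\<And>s. s \<in> T \<Longrightarrow> p s \<in> {a..b}) \<Longrightarrow>
    continuous_on T (\<lambda>s. current (p s) (q s))"
  for p :: "'z::topological_space \<Rightarrow> real"
  using continuous_on_compose2[OF continuous_on_current_gen, of T "\<lambda>s. (p s, q s)"]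
  by (auto simp: image_subset_iff intro!: continuous_on_Pair)

lemma current_boundary: "t \<in> {a..b} \<Longrightarrow> \<bar>x\<bar> = r \<Longrightarrow> current t x = 0"
proof -
  assume *: "t \<in> {a..b}" "\<bar>x\<bar> = r"
  have "g \<alpha> t (x, v) = 0" if "\<alpha> \<in> {1..N}" for \<alpha> v
    using supp[OF that *(1), of x "fst v" "snd v"] *(2) by auto
  then show ?thesis by (simp add: current_def)
qed

text \<open>The continuity equation at a fixed \<open>x\<close>: when the transport equation is
  integrated in \<open>v\<close>, the force term drops out because \<open>field t x\<close> is
  constant in \<open>v\<close> and the densities vanish at the ends of the \<open>v1\<close>
  range.\<close>

lemma integral_gt_velocity:
  assumes t: "t \<in> {a..b}" and x: "\<bar>x\<bar> \<le> r"
  shows "integral (cbox (- r, - r) (r, r)) (\<lambda>v. \<Sum>\<alpha> = 1..N. e \<alpha> * gt \<alpha> t (x, v))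
    = - integral (cbox (- r, - r) (r, r)) (\<lambda>v. \<Sum>\<alpha> = 1..N. e \<alpha> * (fst v * gx \<alpha> t (x, v)))"
proof -
  let ?V = "cbox (- r, - r) (r, r :: real)"
  have 0: "integral ?V (\<lambda>v. gv \<alpha> t (x, v)) = 0" if \<alpha>: "\<alpha> \<in> {1..N}" for \<alpha>
  proof (rule integral_cbox_eq_0_of_derivative[where g = "\<lambda>v. g \<alpha> t (x, v)"])
    show "- r \<le> r" using r_pos by simp
    show "continuous_on ?V (\<lambda>v. gv \<alpha> t (x, v))"
      using t \<alpha> by (intro continuous_intros continuous_on_g) auto
    show "((\<lambda>v1. g \<alpha> t (x, v1, v2)) has_real_derivative gv \<alpha> t (x, v1, v2)) (at v1 within {- r..r})" for v1 v2
      by (rule has_field_derivative_at_within[OF g_v[OF \<alpha> t]])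
    have "g \<alpha> t (x, w, v2) = 0" if "\<bar>w\<bar> = r" for w v2
      using supp[OF \<alpha> t, of x w v2] that by auto
    then show "g \<alpha> t (x, - r, v2) = g \<alpha> t (x, r, v2)" for v2
      using r_pos by simp
  qed
  have "integral ?V (\<lambda>v. \<Sum>\<alpha> = 1..N. e \<alpha> * gt \<alpha> t (x, v))
     = integral ?V (\<lambda>v. - (\<Sum>\<alpha> = 1..N. e \<alpha> * (fst v * gx \<alpha> t (x, v)))
         - (\<Sum>\<alpha> = 1..N. (e \<alpha> * e \<alpha> * field t x) * gv \<alpha> t (x, v)))"
  proof (rule integral_cong)
    fix v :: "real \<times> real"
    have "e \<alpha> * gt \<alpha> t (x, v) = - (e \<alpha> * (fst v * gx \<alpha> t (x, v))) - (e \<alpha> * e \<alpha> * field t x) * gv \<alpha> t (x, v)"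
      if "\<alpha> \<in> {1..N}" for \<alpha>
    proof -
      have "gt \<alpha> t (x, v) = - (fst v * gx \<alpha> t (x, v)) - e \<alpha> * field t x * gv \<alpha> t (x, v)"
        using pde[OF that t x, of "fst v" "snd v"] by simp
      then show ?thesis by (simp only:) (simp add: algebra_simps)
    qed
    then show "(\<Sum>\<alpha> = 1..N. e \<alpha> * gt \<alpha> t (x, v)) = - (\<Sum>\<alpha> = 1..N. e \<alpha> * (fst v * gx \<alpha> t (x, v)))
         - (\<Sum>\<alpha> = 1..N. (e \<alpha> * e \<alpha> * field t x) * gv \<alpha> t (x, v))"
      by (simp add: sum_subtractf sum_negf)
  qed
  also have "\<dots> = - integral ?V (\<lambda>v. \<Sum>\<alpha> = 1..N. e \<alpha> * (fst v * gx \<alpha> t (x, v)))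
     - integral ?V (\<lambda>v. \<Sum>\<alpha> = 1..N. (e \<alpha> * e \<alpha> * field t x) * gv \<alpha> t (x, v))"
    using t by (subst Henstock_Kurzweil_Integration.integral_diff)
      (auto intro!: integrable_continuous continuous_intros continuous_on_g)
  also have "integral ?V (\<lambda>v. \<Sum>\<alpha> = 1..N. (e \<alpha> * e \<alpha> * field t x) * gv \<alpha> t (x, v)) = 0"
    using t by (subst integral_sum) (auto simp: 0 intro!: integrable_continuous continuous_intros continuous_on_g)
  finally show ?thesis by simp
qed

lemma current_has_derivative_x:
  assumes t: "t \<in> {a..b}"
  shows "((\<lambda>x. current t x) has_real_derivative
    integral (cbox (- r, - r) (r, r)) (\<lambda>v. \<Sum>\<alpha> = 1..N. e \<alpha> * (fst v * gx \<alpha> t (x, v)))) (at x)"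
  unfolding current_def
proof (rule leibniz_rule_field_derivative[where U = UNIV, simplified])
  show "((\<lambda>x. \<Sum>\<alpha> = 1..N. e \<alpha> * (fst v * g \<alpha> t (x, v))) has_real_derivative
      (\<Sum>\<alpha> = 1..N. e \<alpha> * (fst v * gx \<alpha> t (x, v)))) (at x)" for x v
    using t by (intro DERIV_sum DERIV_cmult g_x) auto
  show "(\<lambda>v. \<Sum>\<alpha> = 1..N. e \<alpha> * (fst v * g \<alpha> t (x, v))) integrable_on cbox (- r, - r) (r, r)" for x
    using t by (intro integrable_continuous continuous_intros continuous_on_g) auto
  show "continuous_on (UNIV \<times> cbox (- r, - r) (r, r)) (\<lambda>(x, v). \<Sum>\<alpha> = 1..N. e \<alpha> * (fst v * gx \<alpha> t (x, v)))"
    unfolding case_prod_unfold using t by (intro continuous_intros continuous_on_g) auto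
qed

lemma charge_has_derivative_t:
  assumes t: "t \<in> {a..b}"
  shows "((\<lambda>t. charge t x) has_real_derivative
    integral (cbox (- r, - r) (r, r)) (\<lambda>v. \<Sum>\<alpha> = 1..N. e \<alpha> * gt \<alpha> t (x, v))) (at t within {a..b})"
  unfolding box_charge_def
proof (rule leibniz_rule_field_derivative)
  show "((\<lambda>t. \<Sum>\<alpha> = 1..N. e \<alpha> * g \<alpha> t (x, v)) has_real_derivative
      (\<Sum>\<alpha> = 1..N. e \<alpha> * gt \<alpha> t (x, v))) (at t within {a..b})" if "t \<in> {a..b}" for t v
    using that by (intro DERIV_sum DERIV_cmult g_t) auto
  show "(\<lambda>v. \<Sum>\<alpha> = 1..N. e \<alpha> * g \<alpha> t (x, v)) integrable_on cbox (- r, - r) (r, r)" if "t \<in> {a..b}" for t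
    using that by (intro integrable_continuous continuous_intros continuous_on_g) auto
  show "continuous_on ({a..b} \<times> cbox (- r, - r) (r, r)) (\<lambda>(t, v). \<Sum>\<alpha> = 1..N. e \<alpha> * gt \<alpha> t (x, v))"
    unfolding case_prod_unfold by (intro continuous_intros continuous_on_g) auto
qed (use t in auto)

text \<open>Integrating the continuity equation over \<open>{-r..x}\<close> leaves the difference of
  the currents at the two ends, and the one at \<open>-r\<close> is 0.\<close>

lemma partial_charge_has_derivative_t:
  assumes t: "t \<in> {a..b}" and x: "x \<in> {-r..r}"
  shows "((\<lambda>t. integral {-r..x} (charge t)) has_real_derivative - current t x) (at t within {a..b})"
proof -
  let ?V = "cbox (- r, - r) (r, r :: real)"
  have "((\<lambda>t. integral (cbox (-r) x) (charge t)) has_real_derivative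
    integral (cbox (-r) x) (\<lambda>y. integral ?V (\<lambda>v. \<Sum>\<alpha> = 1..N. e \<alpha> * gt \<alpha> t (y, v)))) (at t within {a..b})"
  proof (rule leibniz_rule_field_derivative)
    show "charge t integrable_on cbox (-r) x" if "t \<in> {a..b}" for t
      using charge_integrable[OF that] by simp
    have "continuous_on (({a..b} \<times> cbox (-r) x) \<times> ?V) (\<lambda>(p, v). \<Sum>\<alpha> = 1..N. e \<alpha> * gt \<alpha> (fst p) (snd p, v))"
      unfolding case_prod_unfold by (intro continuous_intros continuous_on_g) auto
    from integral_continuous_on_param[OF this]
    show "continuous_on ({a..b} \<times> cbox (-r) x) (\<lambda>(t, y). integral ?V (\<lambda>v. \<Sum>\<alpha> = 1..N. e \<alpha> * gt \<alpha> t (y, v)))"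
      by (simp add: case_prod_unfold)
  qed (use t charge_has_derivative_t in auto)
  also have "integral (cbox (-r) x) (\<lambda>y. integral ?V (\<lambda>v. \<Sum>\<alpha> = 1..N. e \<alpha> * gt \<alpha> t (y, v)))
     = integral {-r..x} (\<lambda>y. - integral ?V (\<lambda>v. \<Sum>\<alpha> = 1..N. e \<alpha> * (fst v * gx \<alpha> t (y, v))))"
    unfolding box_real using x by (intro integral_cong integral_gt_velocity[OF t]) auto
  also have "\<dots> = - current t x - (- current t (-r))"
    using x by (intro integral_unique fundamental_theorem_of_calculus)
      (auto simp del: One_nat_def simp flip: has_real_derivative_iff_has_vector_derivative
        intro!: DERIV_minus has_field_derivative_at_within[OF current_has_derivative_x[OF t]])
  also have "current t (-r) = 0" using r_pos by (intro current_boundary[OF t]) auto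
  finally show ?thesis by simp
qed

text \<open>Relative to the partial charge, \<open>field_eq\<close> subtracts half of the total
  signed charge, whose rate of change is the current at \<open>r\<close>, again 0.\<close>

lemma field_has_derivative_t:
  assumes t: "t \<in> {a..b}" and x: "x \<in> {-r..r}"
  shows "((\<lambda>t. field t x) has_real_derivative - current t x) (at t within {a..b})"
proof -
  have "current t r = 0" using r_pos by (intro current_boundary[OF t]) auto
  moreover have "((\<lambda>t. integral {-r..x} (charge t) - 1 / 2 * integral {-r..r} (charge t)) has_real_derivative
    - current t x - 1 / 2 * (- current t r)) (at t within {a..b})"
    using x r_pos by (intro DERIV_diff DERIV_cmult partial_charge_has_derivative_t[OF t]) auto
  ultimately show ?thesis
    using has_derivative_transform[OF t, of "\<lambda>t. field t x"] field_eq[OF _ x]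
    by (simp add: has_field_derivative_def)
qed

section \<open>Energy and the bound on the integrated current\<close>

definition kinetic :: "nat \<Rightarrow> real \<Rightarrow> real" where
  "kinetic \<alpha> t = integral (phase_box r) (\<lambda>z. g \<alpha> t z * ((fst (snd z))\<^sup>2 / 2))"

text \<open>The field energy is taken over the box. Neutrality is what will bound its initial value
  independently of \<open>r\<close>: otherwise the field would be a nonzero constant to either side
  of the support and the integral would grow with \<open>r\<close>.\<close>

definition energy :: "real \<Rightarrow> real" where
  "energy t = (\<Sum>\<alpha> = 1..N. kinetic \<alpha> t) + integral {-r..r} (\<lambda>x. (field t x)\<^sup>2 / 2)"

lemma kinetic_has_derivative:
  assumes t: "t \<in> {a..b}" and \<alpha>: "\<alpha> \<in> {1..N}"
  shows "(kinetic \<alpha> has_real_derivative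
    integral (phase_box r) (\<lambda>z. field t (fst z) * (e \<alpha> * (fst (snd z) * g \<alpha> t z)))) (at t within {a..b})"
proof -
  interpret transport a b r "\<lambda>t x. e \<alpha> * field t x" "g \<alpha>" "gt \<alpha>" "gx \<alpha>" "gv \<alpha>"
    by (rule transport_species[OF \<alpha>])
  show ?thesis
    unfolding kinetic_def
    by (rule DERIV_cong[OF weak_form[where \<phi> = "\<lambda>t z. (fst (snd z))\<^sup>2 / 2" and \<phi>t = "\<lambda>_ _. 0"
          and \<phi>x = "\<lambda>_ _. 0" and \<phi>v = "\<lambda>_ z. fst (snd z)"]])
       (use t in \<open>auto intro!: continuous_intros derivative_eq_intros integral_cong
          simp: case_prod_unfold algebra_simps\<close>)
qed

lemma field_energy_has_derivative:
  assumes t: "t \<in> {a..b}"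
  shows "((\<lambda>t. integral {-r..r} (\<lambda>x. (field t x)\<^sup>2 / 2)) has_real_derivative
    - integral {-r..r} (\<lambda>x. field t x * current t x)) (at t within {a..b})"
proof -
  have "((\<lambda>t. integral (cbox (-r) r) (\<lambda>x. (field t x)\<^sup>2 / 2)) has_real_derivative
    integral (cbox (-r) r) (\<lambda>x. - (field t x * current t x))) (at t within {a..b})"
  proof (rule leibniz_rule_field_derivative)
    show "((\<lambda>t. (field t x)\<^sup>2 / 2) has_real_derivative - (field t x * current t x)) (at t within {a..b})"
      if "t \<in> {a..b}" "x \<in> cbox (-r) r" for t x
      using field_has_derivative_t[of t x] that by (auto intro!: derivative_eq_intros)
    show "(\<lambda>x. (field t x)\<^sup>2 / 2) integrable_on cbox (-r) r" if "t \<in> {a..b}" for t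
      using that by (intro integrable_continuous continuous_intros continuous_on_field) auto
    show "continuous_on ({a..b} \<times> cbox (-r) r) (\<lambda>(t, x). - (field t x * current t x))"
      unfolding case_prod_unfold
      by (intro continuous_intros continuous_on_field continuous_on_current) auto
  qed (use t in auto)
  then show ?thesis by simp
qed

text \<open>The work done by the field on all particles is the integral of
  \<open>field * current\<close>, by summing over the species and integrating in \<open>v\<close>
  first; the field energy decreases at exactly this rate.\<close>

lemma energy_conserved:
  assumes t: "t \<in> {a..b}"
  shows "energy t = energy a"
proof -
  have "(energy has_real_derivative 0) (at t within {a..b})" if t: "t \<in> {a..b}" for t
  proof -
    let ?V = "cbox (- r, - r) (r, r :: real)"
    have "(\<Sum>\<alpha> = 1..N. integral (phase_box r) (\<lambda>z. field t (fst z) * (e \<alpha> * (fst (snd z) * g \<alpha> t z))))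
      = integral (phase_box r) (\<lambda>z. \<Sum>\<alpha> = 1..N. field t (fst z) * (e \<alpha> * (fst (snd z) * g \<alpha> t z)))"
      using t by (subst integral_sum)
        (auto intro!: integrable_continuous continuous_intros continuous_on_g continuous_on_field)
    also have "\<dots> = integral (cbox (-r) r) (\<lambda>x. integral ?V (\<lambda>v. field t x * (\<Sum>\<alpha> = 1..N. e \<alpha> * (fst v * g \<alpha> t (x, v)))))"
      using t by (subst integral_prod_continuous)
        (auto intro!: continuous_intros continuous_on_g continuous_on_field simp: sum_distrib_left)
    also have "\<dots> = integral {-r..r} (\<lambda>x. field t x * current t x)"
      by (simp add: current_def)
    finally have "(\<Sum>\<alpha> = 1..N. integral (phase_box r) (\<lambda>z. field t (fst z) * (e \<alpha> * (fst (snd z) * g \<alpha> t z))))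
      + - integral {-r..r} (\<lambda>x. field t x * current t x) = 0" by simp
    moreover have "(energy has_real_derivative
      (\<Sum>\<alpha> = 1..N. integral (phase_box r) (\<lambda>z. field t (fst z) * (e \<alpha> * (fst (snd z) * g \<alpha> t z))))
      + - integral {-r..r} (\<lambda>x. field t x * current t x)) (at t within {a..b})"
      unfolding energy_def
      by (intro DERIV_add DERIV_sum kinetic_has_derivative field_energy_has_derivative t) auto
    ultimately show ?thesis by simp
  qed
  from mvt_within[OF this, of a t] t ab show ?thesis by auto
qed

lemma kinetic_nonneg:
  assumes "\<alpha> \<in> {1..N}" "t \<in> {a..b}"
  shows "0 \<le> kinetic \<alpha> t"
  unfolding kinetic_def
  by (intro Henstock_Kurzweil_Integration.integral_nonneg integrable_continuous continuous_intros continuous_on_g)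
     (use assms nonneg in auto)

text \<open>Comes from \<open>\<bar>v1\<bar> \<le> 1/2 + v1^2/2\<close>. The first term, weighted
  with the densities, yields half the total charge; the second yields kinetic energies, each at most
  the full energy because all its parts are nonnegative.\<close>

definition current_bound :: real where
  "current_bound = total_charge a / 2 + (\<Sum>\<alpha> = 1..N. \<bar>e \<alpha>\<bar>) * energy a"

lemma kinetic_le_energy:
  assumes "\<alpha> \<in> {1..N}" "t \<in> {a..b}"
  shows "kinetic \<alpha> t \<le> energy a"
proof -
  have "kinetic \<alpha> t \<le> (\<Sum>\<alpha> = 1..N. kinetic \<alpha> t)"
    by (rule member_le_sum) (use assms kinetic_nonneg in auto)
  moreover have "0 \<le> integral {-r..r} (\<lambda>x. (field t x)\<^sup>2 / 2)"
    using assms by (intro Henstock_Kurzweil_Integration.integral_nonneg integrable_continuous_real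
        continuous_intros continuous_on_field) auto
  ultimately show ?thesis using energy_conserved[OF assms(2)] by (simp add: energy_def)
qed

lemma abs_integral_current_le:
  assumes t: "t \<in> {a..b}" and x: "x \<in> {-r..r}"
  shows "\<bar>integral {-r..x} (current t)\<bar> \<le> current_bound"
proof -
  have "\<bar>integral {-r..x} (current t)\<bar> \<le> integral {-r..x} (\<lambda>x. \<bar>current t x\<bar>)"
    using t by (subst real_norm_def[symmetric], intro integral_norm_bound_integral
      integrable_continuous_real continuous_intros continuous_on_current) auto
  also have "\<dots> \<le> (\<Sum>\<alpha> = 1..N. \<bar>e \<alpha>\<bar> * integral (phase_box r) (\<lambda>z. \<bar>fst (snd z)\<bar> * g \<alpha> t z))"
    using abs_integral_moment_le[OF t, of fst "-r" x] x by (simp add: current_def continuous_on_fst)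
  also have "\<dots> \<le> (\<Sum>\<alpha> = 1..N. \<bar>e \<alpha>\<bar> * (mass \<alpha> t / 2 + energy a))"
  proof (intro sum_mono mult_left_mono)
    fix \<alpha> assume \<alpha>: "\<alpha> \<in> {1..N}"
    have "integral (phase_box r) (\<lambda>z. \<bar>fst (snd z)\<bar> * g \<alpha> t z)
      \<le> integral (phase_box r) (\<lambda>z. g \<alpha> t z / 2 + g \<alpha> t z * ((fst (snd z))\<^sup>2 / 2))"
    proof (rule integral_le)
      fix z :: "real \<times> real \<times> real"
      have "\<bar>fst (snd z)\<bar> \<le> 1 / 2 + (fst (snd z))\<^sup>2 / 2"
        using sum_squares_bound[of 1 "\<bar>fst (snd z)\<bar>"] by simp
      from mult_left_mono[OF this nonneg[OF \<alpha> t, of z]]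
      show "\<bar>fst (snd z)\<bar> * g \<alpha> t z \<le> g \<alpha> t z / 2 + g \<alpha> t z * ((fst (snd z))\<^sup>2 / 2)"
        by (simp add: algebra_simps)
    qed (intro integrable_continuous continuous_intros continuous_on_g, use t \<alpha> in auto)+
    also have "\<dots> = mass \<alpha> t / 2 + kinetic \<alpha> t"
      unfolding mass_def kinetic_def
      using t \<alpha> by (subst Henstock_Kurzweil_Integration.integral_add)
        (auto intro!: integrable_continuous continuous_intros continuous_on_g)
    finally show "integral (phase_box r) (\<lambda>z. \<bar>fst (snd z)\<bar> * g \<alpha> t z) \<le> mass \<alpha> t / 2 + energy a"
      using kinetic_le_energy[OF \<alpha> t] by linarith
  qed auto
  also have "\<dots> = current_bound"
    using total_charge_conserved[OF t]
    by (simp add: current_bound_def total_charge_def sum_distrib_right sum.distrib distrib_left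
        flip: sum_divide_distrib)
  finally show ?thesis .
qed

lemma current_bound_nonneg: "0 \<le> current_bound"
  using abs_integral_current_le[of a "-r"] ab r_pos by auto

section \<open>The potential and the velocity bound on a box\<close>

text \<open>Normalized to vanish at \<open>-r\<close>, with \<open>x\<close>-derivative
  \<open>+field\<close>, so that \<open>- e \<alpha> * potential\<close> is the potential energy of
  a particle of species \<open>\<alpha>\<close>.\<close>

definition potential :: "real \<Rightarrow> real \<Rightarrow> real" where "potential t x = integral {-r..x} (field t)"

lemma continuous_on_potential: "continuous_on ({a..b} \<times> {-r..r}) (\<lambda>(t, x). potential t x)"
  unfolding potential_def by (intro continuous_on_integral_upper continuous_on_field_gen)

lemma potential_has_derivative_x:
  assumes t: "t \<in> {a..b}" and x: "x \<in> {-r..r}"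
  shows "((\<lambda>x. potential t x) has_real_derivative field t x) (at x within {-r..r})"
  unfolding potential_def has_real_derivative_iff_has_vector_derivative
  using t x by (intro integral_has_vector_derivative continuous_on_field continuous_intros) auto

lemma potential_has_derivative_t:
  assumes t: "t \<in> {a..b}" and x: "x \<in> {-r..r}"
  shows "((\<lambda>t. potential t x) has_real_derivative - integral {-r..x} (current t)) (at t within {a..b})"
proof -
  have "((\<lambda>t. integral (cbox (-r) x) (field t)) has_real_derivative
    integral (cbox (-r) x) (\<lambda>y. - current t y)) (at t within {a..b})"
  proof (rule leibniz_rule_field_derivative)
    show "((\<lambda>t. field t y) has_real_derivative - current t y) (at t within {a..b})"
      if "t \<in> {a..b}" "y \<in> cbox (-r) x" for t y
      using field_has_derivative_t[of t y] that x by auto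
    show "field t integrable_on cbox (-r) x" if "t \<in> {a..b}" for t
      using that x by (intro integrable_continuous continuous_intros continuous_on_field) auto
    show "continuous_on ({a..b} \<times> cbox (-r) x) (\<lambda>(t, y). - current t y)"
      unfolding case_prod_unfold by (intro continuous_intros continuous_on_current) auto
  qed (use t in auto)
  then show ?thesis by (simp add: potential_def)
qed

lemma abs_potential_le:
  assumes t: "t \<in> {a..b}" and x: "x \<in> {-r..r}"
  shows "\<bar>potential t x\<bar> \<le> \<bar>potential a x\<bar> + current_bound * (t - a)"
proof -
  obtain \<xi> where \<xi>: "\<xi> \<in> {a..t}" "potential t x - potential a x = - integral {-r..x} (current \<xi>) * (t - a)"
    using mvt_within[OF potential_has_derivative_t[OF _ x], of a t] t by auto
  have "\<bar>- integral {-r..x} (current \<xi>) * (t - a)\<bar> \<le> current_bound * (t - a)"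
    using abs_integral_current_le[of \<xi> x] \<xi>(1) t x by (auto simp: abs_mult intro!: mult_right_mono)
  then show ?thesis using \<xi>(2) by linarith
qed

text \<open>Along the flow the terms \<open>- v1 * e \<alpha> * field\<close> and
  \<open>+ e \<alpha> * field * v1\<close> cancel, so the particle energy changes only through the
  explicit time dependence of the potential. The linear term in \<open>?h\<close> is chosen to
  outweigh that change, and the constant \<open>n\<^sup>2 / 2 + \<bar>e \<alpha>\<bar> * p\<close>
  to dominate the particle energy at time \<open>a\<close>.\<close>

lemma velocity_bound:
  assumes \<alpha>: "\<alpha> \<in> {1..N}"
    and n: "\<And>x v1 v2. g \<alpha> a (x, v1, v2) \<noteq> 0 \<Longrightarrow> \<bar>v1\<bar> \<le> n"
    and p: "\<And>x. x \<in> {-r..r} \<Longrightarrow> \<bar>potential a x\<bar> \<le> p"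
    and t: "t \<in> {a..b}" and z: "g \<alpha> t (x, v1, v2) \<noteq> 0"
  shows "v1\<^sup>2 \<le> n\<^sup>2 + 4 * (\<bar>e \<alpha>\<bar> * (p + current_bound * (t - a)))"
proof -
  interpret transport a b r "\<lambda>t x. e \<alpha> * field t x" "g \<alpha>" "gt \<alpha>" "gx \<alpha>" "gv \<alpha>"
    by (rule transport_species[OF \<alpha>])
  let ?h = "\<lambda>t z. (fst (snd z))\<^sup>2 / 2 - e \<alpha> * potential t (fst z) - (n\<^sup>2 / 2 + \<bar>e \<alpha>\<bar> * p)
    - \<bar>e \<alpha>\<bar> * current_bound * (t - a)"
  have Bx: "fst z \<in> {-r..r}" if "z \<in> phase_box r" for z using that by (cases z) auto
  have cpot: "continuous_on ({a..b} \<times> phase_box r) (\<lambda>q. potential (fst q) (fst (snd q)))"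
    using continuous_on_compose2[OF continuous_on_potential, of "{a..b} \<times> phase_box r" "\<lambda>q. (fst q, fst (snd q))"] Bx
    by (force intro!: continuous_intros)
  have ccur: "continuous_on ({a..b} \<times> {-r..r}) (\<lambda>(t, x). integral {-r..x} (current t))"
    by (intro continuous_on_integral_upper continuous_on_subset[OF continuous_on_current_gen]) auto
  have ccur': "continuous_on ({a..b} \<times> phase_box r) (\<lambda>q. integral {-r..fst (snd q)} (current (fst q)))"
    using continuous_on_compose2[OF ccur, of "{a..b} \<times> phase_box r" "\<lambda>q. (fst q, fst (snd q))"] Bx
    by (force intro!: continuous_intros)
  have "?h t (x, v1, v2) \<le> 0"
  proof (rule support_propagation[where h = ?h
        and ht = "\<lambda>t z. e \<alpha> * integral {-r..fst z} (current t) - \<bar>e \<alpha>\<bar> * current_bound"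
        and hx = "\<lambda>t z. - (e \<alpha> * field t (fst z))" and hv = "\<lambda>t z. fst (snd z)" and \<sigma> = 1 and ?t0.0 = a,
        OF _ _ _ _ _ _ _ _ _ _ _ _ t z])
    show "continuous_on ({a..b} \<times> phase_box r) (\<lambda>(t, z). ?h t z)"
      unfolding case_prod_unfold by (intro continuous_intros cpot) auto
    show "continuous_on ({a..b} \<times> phase_box r) (\<lambda>(t, z). e \<alpha> * integral {-r..fst z} (current t) - \<bar>e \<alpha>\<bar> * current_bound)"
      unfolding case_prod_unfold by (intro continuous_intros ccur')
    show "continuous_on ({a..b} \<times> phase_box r) (\<lambda>(t, z). - (e \<alpha> * field t (fst z)))"
      unfolding case_prod_unfold by (intro continuous_intros continuous_on_field Bx) auto
    show "continuous_on ({a..b} \<times> phase_box r) (\<lambda>(t :: real, z). fst (snd z))"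
      unfolding case_prod_unfold by (intro continuous_intros)
    show "((\<lambda>s. ?h s z) has_real_derivative e \<alpha> * integral {-r..fst z} (current t) - \<bar>e \<alpha>\<bar> * current_bound)
      (at t within {a..b})" if "t \<in> {a..b}" "z \<in> phase_box r" for t z
      using potential_has_derivative_t[OF that(1) Bx[OF that(2)]] by (auto intro!: derivative_eq_intros)
    show "((\<lambda>x. ?h t (x, v1, v2)) has_real_derivative - (e \<alpha> * field t (fst (x, v1, v2)))) (at x within {-r..r})"
      if "t \<in> {a..b}" "(x, v1, v2) \<in> phase_box r" for t x v1 v2
      using potential_has_derivative_x[OF that(1), of x] that(2) by (auto intro!: derivative_eq_intros)
    show "((\<lambda>w. ?h t (x, w, v2)) has_real_derivative fst (snd (x, v1, v2))) (at v1 within {-r..r})"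
      for t x v1 v2
      by (auto intro!: derivative_eq_intros)
    show "g \<alpha> a z = 0" if "z \<in> phase_box r" "0 < ?h a z" for z
    proof (rule ccontr)
      assume "g \<alpha> a z \<noteq> 0"
      then have "\<bar>fst (snd z)\<bar> \<le> \<bar>n\<bar>" using n[of "fst z" "fst (snd z)" "snd (snd z)"] by auto
      then have "(fst (snd z))\<^sup>2 \<le> n\<^sup>2" by (simp add: abs_le_square_iff)
      moreover have "\<bar>e \<alpha> * potential a (fst z)\<bar> \<le> \<bar>e \<alpha>\<bar> * p"
        using p[OF Bx[OF that(1)]] by (auto simp: abs_mult intro!: mult_left_mono)
      ultimately show False using that(2) by auto
    qed
    show "1 * (e \<alpha> * integral {-r..fst z} (current t) - \<bar>e \<alpha>\<bar> * current_bound
        + fst (snd z) * - (e \<alpha> * field t (fst z)) + e \<alpha> * field t (fst z) * fst (snd z)) \<le> 0"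
      if "t \<in> {a..b}" "z \<in> phase_box r" for t z
    proof -
      have "\<bar>e \<alpha> * integral {-r..fst z} (current t)\<bar> \<le> \<bar>e \<alpha>\<bar> * current_bound"
        using abs_integral_current_le[OF that(1) Bx[OF that(2)]] by (auto simp: abs_mult intro!: mult_left_mono)
      then show ?thesis by (auto simp: algebra_simps)
    qed
  qed (use ab in auto)
  moreover have "x \<in> {-r..r}" using supp[OF t z] by auto
  then have "\<bar>e \<alpha> * potential t x\<bar> \<le> \<bar>e \<alpha>\<bar> * (p + current_bound * (t - a))"
    using abs_potential_le[OF t] p by (force simp: abs_mult intro!: mult_left_mono)
  moreover have "\<bar>e \<alpha>\<bar> * (p + current_bound * (t - a)) = \<bar>e \<alpha>\<bar> * p + \<bar>e \<alpha>\<bar> * current_bound * (t - a)"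
    by (simp add: algebra_simps)
  \<comment> \<open>Factor 4: doubling \<open>?h \<le> 0\<close> gives twice
    \<open>\<bar>e \<alpha>\<bar> * (p + current_bound * (t - a))\<close> from the subtracted terms,
    and the same amount again from the potential at time \<open>t\<close>.\<close>
  ultimately show ?thesis by (simp add: abs_le_iff)
qed

text \<open>Removes \<open>r\<close> from \<open>velocity_bound\<close>. As the initial field lives
  on \<open>{-n..n}\<close> and is at most \<open>D\<close> there, the initial potential is at most
  \<open>2 * n * D\<close> and the initial field energy at most
  \<open>2 * n * (D\<^sup>2 / 2)\<close>; the initial kinetic energies contribute at most
  \<open>n\<^sup>2 / 2 * M\<close>. The factor multiplying \<open>t - a\<close> is
  \<open>current_bound\<close> with these values inserted.\<close>

lemma velocity_growth:
  assumes \<alpha>: "\<alpha> \<in> {1..N}"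
    and init: "\<And>\<alpha> x v1 v2. \<alpha> \<in> {1..N} \<Longrightarrow> g \<alpha> a (x, v1, v2) \<noteq> 0 \<Longrightarrow> \<bar>x\<bar> < n \<and> \<bar>v1\<bar> < n \<and> \<bar>v2\<bar> < n"
    and n: "0 \<le> n" "n \<le> r"
    and neutral: "integral {-r..r} (charge a) = 0"
    and D: "D = total_charge a" and M: "M = (\<Sum>\<alpha> = 1..N. mass \<alpha> a)" and S: "S = (\<Sum>\<alpha> = 1..N. \<bar>e \<alpha>\<bar>)"
    and t: "t \<in> {a..b}" and z: "g \<alpha> t (x, v1, v2) \<noteq> 0"
  shows "v1\<^sup>2 \<le> n\<^sup>2 + 4 * (S * (2 * n * D + (D / 2 + S * (n\<^sup>2 / 2 * M + n * D\<^sup>2)) * (t - a)))"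
proof -
  have a: "a \<in> {a..b}" using ab by simp
  have D0: "0 \<le> D" using total_charge_nonneg[OF a] D by simp
  have S0: "0 \<le> S" unfolding S by (intro sum_nonneg) auto
  have charge0: "charge a y = 0" if "n \<le> \<bar>y\<bar>" for y
  proof -
    have "g \<alpha> a (y, v) = 0" if "\<alpha> \<in> {1..N}" for \<alpha> v
      using init[OF that, of y "fst v" "snd v"] \<open>n \<le> \<bar>y\<bar>\<close> by auto
    then show ?thesis by (simp add: box_charge_def)
  qed
  \<comment> \<open>To the left and to the right of the initial support the field is minus and plus
    half the total signed charge, which neutrality makes 0.\<close>
  have field0: "field a y = 0" if y: "y \<in> {-r..r} - {-n..n}" for y
  proof (cases "y < 0")
    case True
    then have "integral {-r..y} (charge a) = integral {-r..y} (\<lambda>_. 0)"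
      using y by (intro integral_cong charge0) auto
    then show ?thesis using y neutral by (simp add: field_eq[OF a])
  next
    case False
    then have "integral {y..r} (charge a) = integral {y..r} (\<lambda>_. 0)"
      using y by (intro integral_cong charge0) auto
    moreover have "integral {-r..y} (charge a) + integral {y..r} (charge a) = integral {-r..r} (charge a)"
      using y by (intro Henstock_Kurzweil_Integration.integral_combine charge_integrable[OF a]) auto
    ultimately show ?thesis using neutral by (simp add: box_field_def)
  qed
  have fieldD: "\<bar>field a y\<bar> \<le> D" if "y \<in> {-r..r}" for y
    using abs_field_le[OF a that] D by simp
  have cont_field: "continuous_on {c..d} (field a)" if "{c..d} \<subseteq> {-r..r}" for c d
    using a that by (intro continuous_on_field continuous_intros) auto
  have outside: "integral {-r..r} h = integral {-n..n} h"
    if "\<And>y. y \<in> {-r..r} - {-n..n} \<Longrightarrow> h y = 0" for h :: "real \<Rightarrow> real"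
    by (rule integral_superset) (use that n in auto)
  have "integral {-r..r} (\<lambda>x. (field a x)\<^sup>2 / 2) = integral {-n..n} (\<lambda>x. (field a x)\<^sup>2 / 2)"
    using field0 by (intro outside) auto
  also have "\<dots> \<le> integral {-n..n} (\<lambda>x. D\<^sup>2 / 2)"
  proof (rule integral_le)
    fix x assume "x \<in> {-n..n}"
    then have "\<bar>field a x\<bar> \<le> \<bar>D\<bar>" using fieldD[of x] n by auto
    then show "(field a x)\<^sup>2 / 2 \<le> D\<^sup>2 / 2" by (simp add: abs_le_square_iff)
  qed (use n in \<open>auto intro!: integrable_continuous_real continuous_intros cont_field\<close>)
  also have "\<dots> = n * D\<^sup>2" using n by simp
  finally have PE: "integral {-r..r} (\<lambda>x. (field a x)\<^sup>2 / 2) \<le> n * D\<^sup>2" .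
  have KE: "kinetic \<alpha> a \<le> n\<^sup>2 / 2 * mass \<alpha> a" if \<alpha>: "\<alpha> \<in> {1..N}" for \<alpha>
  proof -
    have "kinetic \<alpha> a \<le> integral (phase_box r) (\<lambda>z. n\<^sup>2 / 2 * g \<alpha> a z)"
      unfolding kinetic_def
    proof (rule integral_le)
      fix z
      show "g \<alpha> a z * ((fst (snd z))\<^sup>2 / 2) \<le> n\<^sup>2 / 2 * g \<alpha> a z"
      proof (cases "g \<alpha> a z = 0")
        case False
        then have "\<bar>fst (snd z)\<bar> \<le> \<bar>n\<bar>"
          using init[OF \<alpha>, of "fst z" "fst (snd z)" "snd (snd z)"] by auto
        then have "(fst (snd z))\<^sup>2 / 2 \<le> n\<^sup>2 / 2" by (simp add: abs_le_square_iff)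
        from mult_left_mono[OF this nonneg[OF \<alpha> a, of z]] show ?thesis by (simp add: mult.commute)
      qed simp
    qed (intro integrable_continuous continuous_intros continuous_on_g, use a \<alpha> in auto)+
    then show ?thesis by (simp add: mass_def)
  qed
  have "(\<Sum>\<alpha> = 1..N. kinetic \<alpha> a) \<le> n\<^sup>2 / 2 * M"
    unfolding M sum_distrib_left by (intro sum_mono KE)
  then have "energy a \<le> n\<^sup>2 / 2 * M + n * D\<^sup>2" using PE by (simp add: energy_def)
  then have J: "current_bound \<le> D / 2 + S * (n\<^sup>2 / 2 * M + n * D\<^sup>2)"
    unfolding current_bound_def S[symmetric] D[symmetric]
    using S0 by (intro add_mono mult_left_mono) auto
  have pot: "\<bar>potential a x\<bar> \<le> 2 * n * D" if x: "x \<in> {-r..r}" for x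
  proof -
    have "\<bar>potential a x\<bar> \<le> integral {-r..x} (\<lambda>y. \<bar>field a y\<bar>)"
      unfolding potential_def using x
      by (subst real_norm_def[symmetric], intro integral_norm_bound_integral)
         (auto intro!: integrable_continuous_real continuous_intros cont_field)
    also have "\<dots> \<le> integral {-r..r} (\<lambda>y. \<bar>field a y\<bar>)"
      using x by (intro integral_subset_le integrable_continuous_real continuous_intros cont_field) auto
    also have "\<dots> = integral {-n..n} (\<lambda>y. \<bar>field a y\<bar>)"
      using field0 by (intro outside) auto
    also have "\<dots> \<le> integral {-n..n} (\<lambda>y. D)"
      using n fieldD by (intro integral_le) (auto intro!: integrable_continuous_real continuous_intros cont_field)
    finally show ?thesis using n by simp
  qed
  have "v1\<^sup>2 \<le> n\<^sup>2 + 4 * (\<bar>e \<alpha>\<bar> * (2 * n * D + current_bound * (t - a)))"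
  proof (rule velocity_bound[OF \<alpha> _ pot t z])
    show "\<bar>v1\<bar> \<le> n" if "g \<alpha> a (x, v1, v2) \<noteq> 0" for x v1 v2
      using init[OF \<alpha> that] by simp
  qed
  also have "\<dots> \<le> n\<^sup>2 + 4 * (S * (2 * n * D + (D / 2 + S * (n\<^sup>2 / 2 * M + n * D\<^sup>2)) * (t - a)))"
  proof (intro add_left_mono mult_left_mono mult_mono mult_right_mono J)
    show "\<bar>e \<alpha>\<bar> \<le> S" unfolding S by (rule member_le_sum) (use \<alpha> in auto)
    show "0 \<le> 2 * n * D + current_bound * (t - a)"
      using n D0 current_bound_nonneg t by auto
  qed (use t S0 J current_bound_nonneg in auto)
  finally show ?thesis .
qed

end

section \<open>Passage from the definition of a solution to boxes and partial derivatives\<close>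

text \<open>Translates the Lebesgue integrals in \<open>rho\<close> and \<open>E1\<close>, over the
  plane or a half-line, into gauge integrals over a box. Integrability, without which the Lebesgue
  integral would default to 0, comes from continuity on the compact box.\<close>

lemma set_integral_lborel_eq_integral_cbox:
  fixes h :: "'a::euclidean_space \<Rightarrow> real"
  assumes cont: "continuous_on (cbox c d) h" and sub: "cbox c d \<subseteq> A"
    and zero: "\<And>y. y \<in> A - cbox c d \<Longrightarrow> h y = 0"
  shows "(LINT y:A|lborel. h y) = integral (cbox c d) h"
proof -
  have "(\<lambda>x. indicator A x *\<^sub>R h x) = (\<lambda>x. indicator (cbox c d) x *\<^sub>R h x)"
    using sub zero by (auto simp: indicator_def fun_eq_iff)
  then have "(LINT y:A|lborel. h y) = (LINT y:cbox c d|lborel. h y)"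
    by (simp add: set_lebesgue_integral_def)
  also have "\<dots> = integral (cbox c d) h"
  proof (rule set_borel_integral_eq_integral)
    have "(\<lambda>x. indicator (cbox c d) x *\<^sub>R h x) = (\<lambda>x. if x \<in> cbox c d then h x else 0)"
      by (auto simp: indicator_def)
    then show "set_integrable lborel (cbox c d) h"
      unfolding set_integrable_def using borel_integrable_compact[OF compact_cbox cont] by simp
  qed
  finally show ?thesis .
qed

lemma phase_box_mono: "n \<le> m \<Longrightarrow> phase_box n \<subseteq> phase_box m"
  by auto

lemma bounded_subset_phase_box:
  assumes "bounded S"
  obtains n where "S \<subseteq> phase_box n"
proof -
  obtain c where c: "S \<subseteq> cbox (-c) c" using bounded_subset_cbox_symmetric[OF assms] .
  obtain c1 c2 c3 where [simp]: "c = (c1, c2, c3)" using prod_cases3 by blast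
  have "cbox (-c) c \<subseteq> phase_box (max c1 (max c2 c3))" by auto
  with c show ?thesis using that by blast
qed

text \<open>The chain rule along lines in the directions of \<open>t\<close>, \<open>x\<close> and
  \<open>v1\<close>. At a fixed time \<open>t \<ge> 0\<close> lines in \<open>x\<close> and
  \<open>v1\<close> stay inside the strip, so these derivatives are two-sided even at
  \<open>t = 0\<close>; the line in \<open>t\<close> is confined to \<open>{0..}\<close>.\<close>

lemma C1_on_strip_partials:
  fixes F :: "real \<Rightarrow> real \<Rightarrow> real \<times> real \<Rightarrow> real"
  assumes "C1_on ({0..} \<times> UNIV) (\<lambda>(t, x, v). F t x v)"
  obtains Ft Fx Fv :: "real \<Rightarrow> real \<times> real \<times> real \<Rightarrow> real" where
    "continuous_on ({0..} \<times> UNIV) (\<lambda>(t, z). F t (fst z) (snd z))"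
    "continuous_on ({0..} \<times> UNIV) (\<lambda>(t, z). Ft t z)"
    "continuous_on ({0..} \<times> UNIV) (\<lambda>(t, z). Fx t z)"
    "continuous_on ({0..} \<times> UNIV) (\<lambda>(t, z). Fv t z)"
    "\<And>t z. 0 \<le> t \<Longrightarrow> ((\<lambda>s. F s (fst z) (snd z)) has_real_derivative Ft t z) (at t within {0..})"
    "\<And>t x v. 0 \<le> t \<Longrightarrow> ((\<lambda>x. F t x v) has_real_derivative Fx t (x, v)) (at x)"
    "\<And>t x v1 v2. 0 \<le> t \<Longrightarrow> ((\<lambda>v1. F t x (v1, v2)) has_real_derivative Fv t (x, v1, v2)) (at v1)"
proof -
  let ?S = "{0..} \<times> UNIV :: (real \<times> real \<times> real \<times> real) set"
  let ?F = "\<lambda>(t, x, v). F t x v"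
  obtain F' where F': "\<And>p. p \<in> ?S \<Longrightarrow> (?F has_derivative blinfun_apply (F' p)) (at p within ?S)"
    and cont: "continuous_on ?S F'"
    using assms unfolding C1_on_def by blast
  have line: "((\<lambda>s. ?F (l s)) has_real_derivative blinfun_apply (F' (l s)) d) (at s within T)"
    if l: "(l has_vector_derivative d) (at s within T)" and T: "l ` T \<subseteq> ?S" and "l s \<in> ?S" for l d s T
  proof -
    have "(?F has_derivative blinfun_apply (F' (l s))) (at (l s) within l ` T)"
      using F'[OF \<open>l s \<in> ?S\<close>] T by (rule has_derivative_subset)
    from diff_chain_within[OF l[unfolded has_vector_derivative_def] this]
    have "((\<lambda>s. ?F (l s)) has_derivative (\<lambda>h. blinfun_apply (F' (l s)) (h *\<^sub>R d))) (at s within T)"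
      by (simp add: o_def)
    then show ?thesis
      by (simp add: has_field_derivative_def blinfun.scaleR_right mult_commute_abs)
  qed
  have cF: "continuous_on ?S ?F" using F' by (rule has_derivative_continuous_on)
  have cd: "continuous_on ?S (\<lambda>p. blinfun_apply (F' p) d)" for d
    using cont by (intro continuous_intros)
  show ?thesis
  proof (rule that[of "\<lambda>t z. blinfun_apply (F' (t, z)) (1, 0, 0, 0)"
        "\<lambda>t z. blinfun_apply (F' (t, z)) (0, 1, 0, 0)" "\<lambda>t z. blinfun_apply (F' (t, z)) (0, 0, 1, 0)"])
    show "continuous_on ?S (\<lambda>(t, z). F t (fst z) (snd z))" using cF by (simp add: case_prod_unfold)
    show "((\<lambda>s. F s (fst z) (snd z)) has_real_derivative blinfun_apply (F' (t, z)) (1, 0, 0, 0)) (at t within {0..})"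
      if "0 \<le> t" for t z
    proof -
      have "((\<lambda>s. (s, z)) has_vector_derivative (1, 0, 0, 0)) (at t within {0..})"
        unfolding has_vector_derivative_def
        by (auto intro!: derivative_eq_intros simp: zero_prod_def)
      from line[OF this] show ?thesis using that by (auto simp: case_prod_unfold)
    qed
    show "((\<lambda>x. F t x v) has_real_derivative blinfun_apply (F' (t, x, v)) (0, 1, 0, 0)) (at x)"
      if "0 \<le> t" for t x v
    proof -
      have "((\<lambda>x. (t, x, v)) has_vector_derivative (0, 1, 0, 0)) (at x within UNIV)"
        unfolding has_vector_derivative_def
        by (auto intro!: derivative_eq_intros simp: zero_prod_def)
      from line[OF this] show ?thesis using that by auto
    qed
    show "((\<lambda>v1. F t x (v1, v2)) has_real_derivative blinfun_apply (F' (t, x, v1, v2)) (0, 0, 1, 0)) (at v1)"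
      if "0 \<le> t" for t x v1 v2
    proof -
      have "((\<lambda>v1. (t, x, v1, v2)) has_vector_derivative (0, 0, 1, 0)) (at v1 within UNIV)"
        unfolding has_vector_derivative_def
        by (auto intro!: derivative_eq_intros simp: zero_prod_def)
      from line[OF this] show ?thesis using that by auto
    qed
  qed (use cd in \<open>simp_all add: case_prod_unfold\<close>)
qed

subsection \<open>Locally uniform bounds on the supports\<close>

text \<open>The partial derivatives are parameters, so that \<open>vector_derivative\<close> and
  \<open>deriv\<close> are eliminated once, in \<open>pde\<close>, and continuity of the derivatives
  can be stated directly.\<close>

locale vlasov_poisson =
  fixes N :: nat and e :: "nat \<Rightarrow> real" and f0 :: "nat \<Rightarrow> real \<Rightarrow> real \<times> real \<Rightarrow> real"
    and f :: "nat \<Rightarrow> real \<Rightarrow> real \<Rightarrow> real \<times> real \<Rightarrow> real"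
    and ft fx fv :: "nat \<Rightarrow> real \<Rightarrow> real \<times> real \<times> real \<Rightarrow> real"
  assumes solution: "vlasov_poisson_solution N e f0 f"
    and f_cont: "\<alpha> \<in> {1..N} \<Longrightarrow> continuous_on ({0..} \<times> UNIV) (\<lambda>(t, z). f \<alpha> t (fst z) (snd z))"
    and ft_cont: "\<alpha> \<in> {1..N} \<Longrightarrow> continuous_on ({0..} \<times> UNIV) (\<lambda>(t, z). ft \<alpha> t z)"
    and fx_cont: "\<alpha> \<in> {1..N} \<Longrightarrow> continuous_on ({0..} \<times> UNIV) (\<lambda>(t, z). fx \<alpha> t z)"
    and fv_cont: "\<alpha> \<in> {1..N} \<Longrightarrow> continuous_on ({0..} \<times> UNIV) (\<lambda>(t, z). fv \<alpha> t z)"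
    and f_t: "\<alpha> \<in> {1..N} \<Longrightarrow> 0 \<le> t \<Longrightarrow>
      ((\<lambda>s. f \<alpha> s (fst z) (snd z)) has_real_derivative ft \<alpha> t z) (at t within {0..})"
    and f_x: "\<alpha> \<in> {1..N} \<Longrightarrow> 0 \<le> t \<Longrightarrow> ((\<lambda>x. f \<alpha> t x v) has_real_derivative fx \<alpha> t (x, v)) (at x)"
    and f_v: "\<alpha> \<in> {1..N} \<Longrightarrow> 0 \<le> t \<Longrightarrow>
      ((\<lambda>v1. f \<alpha> t x (v1, v2)) has_real_derivative fv \<alpha> t (x, v1, v2)) (at v1)"
begin

abbreviation g :: "nat \<Rightarrow> real \<Rightarrow> real \<times> real \<times> real \<Rightarrow> real" where
  "g \<equiv> \<lambda>\<alpha> t z. f \<alpha> t (fst z) (snd z)"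

lemma pde:
  assumes \<alpha>: "\<alpha> \<in> {1..N}" and t: "0 \<le> t"
  shows "ft \<alpha> t (x, v1, v2) + v1 * fx \<alpha> t (x, v1, v2) + e \<alpha> * E1 N e f t x * fv \<alpha> t (x, v1, v2) = 0"
proof -
  have "vector_derivative (\<lambda>s. f \<alpha> s x (v1, v2)) (at t within {0..}) = ft \<alpha> t (x, v1, v2)"
  proof (rule vector_derivative_within)
    \<comment> \<open>A derivative within \<open>{0..}\<close> is unique only at a limit point; a
      neighbourhood to the right of \<open>t\<close> covers \<open>t = 0\<close> as well.\<close>
    have "t islimpt {t..t + 1}" by (simp add: islimpt_Icc)
    then have "t islimpt {0..}" by (rule islimpt_subset) (use t in auto)
    then show "at t within {0..} \<noteq> bot" by (simp add: trivial_limit_within)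
    show "((\<lambda>s. f \<alpha> s x (v1, v2)) has_vector_derivative ft \<alpha> t (x, v1, v2)) (at t within {0..})"
      using f_t[OF \<alpha> t, of "(x, v1, v2)"] by (simp add: has_real_derivative_iff_has_vector_derivative)
  qed
  moreover have "deriv (\<lambda>y. f \<alpha> t y (v1, v2)) x = fx \<alpha> t (x, v1, v2)"
    by (rule DERIV_imp_deriv[OF f_x[OF \<alpha> t]])
  moreover have "deriv (\<lambda>w. f \<alpha> t x (w, v2)) v1 = fv \<alpha> t (x, v1, v2)"
    by (rule DERIV_imp_deriv[OF f_v[OF \<alpha> t]])
  ultimately show ?thesis
    using solution \<alpha> t unfolding vlasov_poisson_solution_def by metis
qed

lemma nonneg: "\<alpha> \<in> {1..N} \<Longrightarrow> 0 \<le> t \<Longrightarrow> 0 \<le> f \<alpha> t x v"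
  using solution unfolding vlasov_poisson_solution_def by blast

lemma continuous_on_g:
  "\<alpha> \<in> {1..N} \<Longrightarrow> continuous_on T p \<Longrightarrow> continuous_on T q \<Longrightarrow> (\<And>s. s \<in> T \<Longrightarrow> 0 \<le> p s) \<Longrightarrow>
    continuous_on T (\<lambda>s. g \<alpha> (p s) (q s))"
  for p :: "'z::topological_space \<Rightarrow> real"
  using continuous_on_compose2[OF f_cont, of \<alpha> T "\<lambda>s. (p s, q s)"]
  by (auto simp: image_subset_iff intro!: continuous_on_Pair)

definition supp_in :: "real \<Rightarrow> real \<Rightarrow> bool" where
  "supp_in n t \<longleftrightarrow> (\<forall>\<alpha>\<in>{1..N}. \<forall>z. g \<alpha> t z \<noteq> 0 \<longrightarrow> z \<in> phase_box n)"

lemma supp_inD: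
  assumes "supp_in n t" "\<alpha> \<in> {1..N}" "f \<alpha> t x v \<noteq> 0"
  shows "(x, v) \<in> phase_box n"
  using assms(1)[unfolded supp_in_def, rule_format, OF assms(2), of "(x, v)"] assms(3) by simp

lemma supp_in_mono: "supp_in n t \<Longrightarrow> n \<le> m \<Longrightarrow> supp_in m t"
  unfolding supp_in_def using phase_box_mono by blast

lemma supp_in_ex:
  assumes "0 \<le> t"
  obtains n where "0 \<le> n" "supp_in n t"
proof -
  have "bounded (\<Union>\<alpha>\<in>{1..N}. {z. g \<alpha> t z \<noteq> 0})"
  proof (intro bounded_UN ballI)
    fix \<alpha> assume "\<alpha> \<in> {1..N}"
    then have "compact (closure {z. (\<lambda>(x, v). f \<alpha> t x v) z \<noteq> 0})"
      using solution assms unfolding vlasov_poisson_solution_def compactly_supported_def by blast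
    then have "bounded (closure {z. g \<alpha> t z \<noteq> 0})"
      by (simp add: case_prod_unfold compact_imp_bounded)
    then show "bounded {z. g \<alpha> t z \<noteq> 0}" using closure_subset by (rule bounded_subset)
  qed auto
  then obtain n where n: "(\<Union>\<alpha>\<in>{1..N}. {z. g \<alpha> t z \<noteq> 0}) \<subseteq> phase_box n"
    by (rule bounded_subset_phase_box)
  then have "supp_in n t" unfolding supp_in_def by blast
  then show ?thesis using that[of "max 0 n"] supp_in_mono by simp
qed

lemma rho_eq:
  assumes t: "0 \<le> t" and s: "supp_in n t"
  shows "rho N e f t x = box_charge N e n g t x"
proof -
  have "(LINT v:UNIV|lborel. (\<Sum>\<alpha> = 1..N. e \<alpha> * f \<alpha> t x v)) = integral (cbox (-n, -n) (n, n)) (\<lambda>v. \<Sum>\<alpha> = 1..N. e \<alpha> * f \<alpha> t x v)"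
  proof (rule set_integral_lborel_eq_integral_cbox)
    have "continuous_on (cbox (-n, -n) (n, n)) (\<lambda>v. \<Sum>\<alpha> = 1..N. e \<alpha> * g \<alpha> t (x, v))"
      using t by (intro continuous_intros continuous_on_g) auto
    then show "continuous_on (cbox (-n, -n) (n, n)) (\<lambda>v. \<Sum>\<alpha> = 1..N. e \<alpha> * f \<alpha> t x v)" by simp
    fix v assume v: "v \<in> UNIV - cbox (-n, -n) (n, n)"
    have "f \<alpha> t x v = 0" if "\<alpha> \<in> {1..N}" for \<alpha>
    proof (rule ccontr)
      assume "f \<alpha> t x v \<noteq> 0"
      then have "(x, v) \<in> phase_box n" using supp_inD[OF s that] by blast
      then show False using v by (cases v) auto
    qed
    then show "(\<Sum>\<alpha> = 1..N. e \<alpha> * f \<alpha> t x v) = 0" by simp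
  qed auto
  then show ?thesis by (simp add: rho_def box_charge_def set_lebesgue_integral_def)
qed

lemma continuous_on_rho:
  assumes t: "0 \<le> t"
  shows "continuous_on UNIV (rho N e f t)"
proof -
  obtain n where n: "supp_in n t" using supp_in_ex[OF t] by blast
  have "continuous_on (UNIV \<times> cbox (-n, -n) (n, n)) (\<lambda>(x, v). \<Sum>\<alpha> = 1..N. e \<alpha> * g \<alpha> t (x, v))"
    unfolding case_prod_unfold using t by (intro continuous_intros continuous_on_g) auto
  from integral_continuous_on_param[OF this] show ?thesis
    by (simp add: rho_eq[OF t n] box_charge_def[abs_def] fun_eq_iff cong: continuous_on_cong)
qed

lemma rho_zero:
  assumes t: "0 \<le> t" and s: "supp_in n t" and x: "n < \<bar>x\<bar>"
  shows "rho N e f t x = 0"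
proof -
  have "f \<alpha> t x v = 0" if "\<alpha> \<in> {1..N}" for \<alpha> v
  proof (rule ccontr)
    assume "f \<alpha> t x v \<noteq> 0"
    then have "(x, v) \<in> phase_box n" using supp_inD[OF s that] by blast
    then show False using x by (cases v) auto
  qed
  then show ?thesis by (simp add: rho_def)
qed

lemma E1_eq:
  assumes t: "0 \<le> t" and s: "supp_in n t" and x: "\<bar>x\<bar> \<le> n"
  shows "E1 N e f t x = box_field N e n g t x"
proof -
  have "(LINT y:{..x}|lborel. rho N e f t y) = integral (cbox (-n) x) (rho N e f t)"
    using x rho_zero[OF t s] by (intro set_integral_lborel_eq_integral_cbox continuous_on_subset[OF continuous_on_rho[OF t]]) auto
  moreover have "(LINT y:{x..}|lborel. rho N e f t y) = integral (cbox x n) (rho N e f t)"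
    using x rho_zero[OF t s] by (intro set_integral_lborel_eq_integral_cbox continuous_on_subset[OF continuous_on_rho[OF t]]) auto
  moreover have "rho N e f t = box_charge N e n g t" using rho_eq[OF t s] by blast
  ultimately show ?thesis by (simp add: E1_def box_field_def)
qed

text \<open>A common support bound over a compact time interval gives access to everything proved on
  boxes. The margin \<open>n < r\<close> makes the densities vanish on the faces of the larger
  box.\<close>

lemma box:
  assumes ab: "0 \<le> a" "a \<le> b" and n: "0 \<le> n" "n < r" and s: "\<And>t. t \<in> {a..b} \<Longrightarrow> supp_in n t"
  shows "vlasov_poisson_box N e a b r g ft fx fv"
proof
  fix \<alpha> t x v1 v2 assume *: "\<alpha> \<in> {1..N}" "t \<in> {a..b}"
  then have t: "0 \<le> t" using ab by auto
  show "\<bar>x\<bar> < r \<and> \<bar>v1\<bar> < r \<and> \<bar>v2\<bar> < r" if "g \<alpha> t (x, v1, v2) \<noteq> 0"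
  proof -
    have "(x, v1, v2) \<in> phase_box n" using s[OF *(2)] *(1) that unfolding supp_in_def by blast
    then show ?thesis using n by auto
  qed
  show "((\<lambda>x. g \<alpha> t (x, v)) has_real_derivative fx \<alpha> t (x, v)) (at x)" for v
    using f_x[OF *(1) t] by simp
  show "((\<lambda>v1. g \<alpha> t (x, v1, v2)) has_real_derivative fv \<alpha> t (x, v1, v2)) (at v1)"
    using f_v[OF *(1) t] by simp
  show "((\<lambda>s. g \<alpha> s z) has_real_derivative ft \<alpha> t z) (at t within {a..b})" for z
    using f_t[OF *(1) t, of z] by (rule has_field_derivative_subset) (use ab in auto)
  show "0 \<le> g \<alpha> t z" for z using nonneg[OF *(1) t] by simp
  show "ft \<alpha> t (x, v1, v2) + v1 * fx \<alpha> t (x, v1, v2) + e \<alpha> * box_field N e r g t x * fv \<alpha> t (x, v1, v2) = 0"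
    if "\<bar>x\<bar> \<le> r"
    using pde[OF *(1) t, of x v1 v2] E1_eq[OF t supp_in_mono[OF s[OF *(2)]] that] n by simp
qed (use ab n in \<open>auto intro: continuous_on_subset[OF f_cont] continuous_on_subset[OF ft_cont]
  continuous_on_subset[OF fx_cont] continuous_on_subset[OF fv_cont]\<close>)

text \<open>Truncation to a fixed box keeps this continuous in \<open>t\<close> even at times when
  the supports do not fit; when \<open>supp_in n t\<close> holds it is the true total
  charge.\<close>

definition charge_in :: "real \<Rightarrow> real \<Rightarrow> real" where
  "charge_in n t = (\<Sum>\<alpha> = 1..N. \<bar>e \<alpha>\<bar> * integral (phase_box n) (g \<alpha> t))"

lemma integral_g_eq:
  assumes "supp_in n t" "n \<le> m" "\<alpha> \<in> {1..N}"
  shows "integral (phase_box m) (g \<alpha> t) = integral (phase_box n) (g \<alpha> t)"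
  by (rule integral_superset) (use assms phase_box_mono[of n m] in \<open>auto simp: supp_in_def\<close>)

lemma charge_in_eq: "supp_in n t \<Longrightarrow> n \<le> m \<Longrightarrow> charge_in m t = charge_in n t"
  unfolding charge_in_def by (intro sum.cong refl) (simp only: integral_g_eq[of n t m])

definition locally_supported :: "real \<Rightarrow> bool" where
  "locally_supported t \<longleftrightarrow> (\<exists>\<delta>>0. \<exists>n. \<forall>s\<ge>0. \<bar>s - t\<bar> < \<delta> \<longrightarrow> supp_in n s)"

lemma locally_supported_Icc:
  assumes "0 \<le> a" "a \<le> b" and loc: "\<And>t. t \<in> {a..b} \<Longrightarrow> locally_supported t"
  obtains n where "0 \<le> n" "\<And>t. t \<in> {a..b} \<Longrightarrow> supp_in n t"
proof -
  \<comment> \<open>The guard \<open>0 \<le> t\<close> is for the bisection principle, whose small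
    intervals around a point may reach beyond \<open>{a..b}\<close> and below 0.\<close>
  have "\<exists>n. \<forall>t\<in>{a..b}. 0 \<le> t \<longrightarrow> supp_in n t"
  proof (rule Bolzano[OF \<open>a \<le> b\<close>])
    fix a b c :: real
    assume "\<exists>n. \<forall>t\<in>{a..b}. 0 \<le> t \<longrightarrow> supp_in n t" "\<exists>n. \<forall>t\<in>{b..c}. 0 \<le> t \<longrightarrow> supp_in n t"
    then obtain n m where nm: "\<forall>t\<in>{a..b}. 0 \<le> t \<longrightarrow> supp_in n t" "\<forall>t\<in>{b..c}. 0 \<le> t \<longrightarrow> supp_in m t"
      by blast
    have "supp_in (max n m) t" if "t \<in> {a..c}" "0 \<le> t" for t
      using nm that supp_in_mono[of n t "max n m"] supp_in_mono[of m t "max n m"]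
      by (cases "t \<le> b") auto
    then show "\<exists>n. \<forall>t\<in>{a..c}. 0 \<le> t \<longrightarrow> supp_in n t" by blast
  next
    fix t assume "a \<le> t" "t \<le> b"
    then obtain \<delta> n where \<delta>: "\<delta> > 0" and n: "\<forall>s\<ge>0. \<bar>s - t\<bar> < \<delta> \<longrightarrow> supp_in n s"
      using loc[of t] unfolding locally_supported_def by auto
    have "supp_in n s" if "c \<le> t" "t \<le> d" "d - c < \<delta>" "s \<in> {c..d}" "0 \<le> s" for c d s
    proof -
      have "\<bar>s - t\<bar> < \<delta>" using that(1-4) unfolding atLeastAtMost_iff by linarith
      then show ?thesis using n \<open>0 \<le> s\<close> by blast
    qed
    then show "\<exists>d>0. \<forall>a b. a \<le> t \<and> t \<le> b \<and> b - a < d \<longrightarrow> (\<exists>n. \<forall>t\<in>{a..b}. 0 \<le> t \<longrightarrow> supp_in n t)"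
      using \<delta> by blast
  qed
  then obtain n where n: "\<forall>t\<in>{a..b}. 0 \<le> t \<longrightarrow> supp_in n t" by blast
  have "supp_in (max 0 n) t" if "t \<in> {a..b}" for t
    using n that \<open>0 \<le> a\<close> supp_in_mono[of n t "max 0 n"] by auto
  then show ?thesis using that[of "max 0 n"] by simp
qed

text \<open>The bound \<open>m\<close> is purely qualitative: it makes the box available but does
  not enter the conclusion, which uses only the data at \<open>p\<close>. The time \<open>p\<close>
  may lie on either side of \<open>q\<close>, so growth is obtained in both time directions.\<close>

lemma supp_in_growth:
  assumes "0 \<le> p" "0 \<le> q" and m: "0 \<le> m" "\<And>t. t \<in> {min p q..max p q} \<Longrightarrow> supp_in m t"
    and n: "0 \<le> n" "supp_in n p"
    and L: "\<bar>p - q\<bar> \<le> L" and c: "(\<Sum>\<alpha> = 1..N. \<bar>e \<alpha>\<bar>) * charge_in n p \<le> c"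
    and t: "t \<in> {min p q..max p q}"
  shows "supp_in (n + c * L + L * (n + c * L)) t"
proof -
  define r where "r = max m n + 1"
  interpret vlasov_poisson_box N e "min p q" "max p q" r g ft fx fv
    by (rule box[where n = "max m n"]) (use assms supp_in_mono[of m _ "max m n"] in \<open>auto simp: r_def\<close>)
  have pab: "p \<in> {min p q..max p q}" by auto
  have tc: "total_charge p = charge_in n p"
    using charge_in_eq[OF n(2), of r] unfolding total_charge_def charge_in_def mass_def
    by (simp add: r_def)
  show ?thesis
    unfolding supp_in_def
  proof (intro ballI allI impI)
    fix \<alpha> z assume \<alpha>: "\<alpha> \<in> {1..N}" and z: "g \<alpha> t z \<noteq> 0"
    have "\<bar>e \<alpha>\<bar> \<le> (\<Sum>\<alpha> = 1..N. \<bar>e \<alpha>\<bar>)" by (rule member_le_sum) (use \<alpha> in auto)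
    then have "\<bar>e \<alpha>\<bar> * total_charge p \<le> (\<Sum>\<alpha> = 1..N. \<bar>e \<alpha>\<bar>) * total_charge p"
      using total_charge_nonneg[OF pab] by (rule mult_right_mono)
    then have c': "\<bar>e \<alpha>\<bar> * total_charge p \<le> c" using c tc by simp
    have init: "z \<in> phase_box n" if "g \<alpha> p z \<noteq> 0" for z using n(2) \<alpha> that unfolding supp_in_def by blast
    show "z \<in> phase_box (n + c * L + L * (n + c * L))"
      by (rule support_growth[OF \<alpha> _ init _ c' n(1) t z]) (use L in auto)
  qed
qed

lemma charge_in_nonneg: "0 \<le> t \<Longrightarrow> 0 \<le> charge_in n t"
  unfolding charge_in_def
  by (intro sum_nonneg mult_nonneg_nonneg Henstock_Kurzweil_Integration.integral_nonneg
      integrable_continuous continuous_on_g continuous_intros) (auto intro: nonneg)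

text \<open>
  Nothing is assumed about the supports near \<open>p\<close>: growing backwards from \<open>q\<close> first bounds them up to \<open>p\<close>,
  which makes the charge at \<open>p\<close> available as the constant of the second application.
\<close>

lemma supp_in_growth_open:
  assumes pq: "0 \<le> p" "0 \<le> q"
    and loc: "\<And>t. t \<in> {min p q..max p q} \<Longrightarrow> t \<noteq> p \<Longrightarrow> locally_supported t"
    and n: "0 \<le> n" "supp_in n p"
    and L: "\<bar>p - q\<bar> \<le> L" and c: "(\<Sum>\<alpha> = 1..N. \<bar>e \<alpha>\<bar>) * charge_in n p \<le> c"
  shows "supp_in (n + c * L + L * (n + c * L)) q"
proof -
  obtain k where k: "0 \<le> k" "supp_in k q" using supp_in_ex[OF pq(2)] by blast
  define c' where "c' = (\<Sum>\<alpha> = 1..N. \<bar>e \<alpha>\<bar>) * charge_in k q"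
  define m where "m = max n (k + c' * L + L * (k + c' * L))"
  \<comment> \<open>For \<open>t \<noteq> p\<close> the closed interval between \<open>q\<close> and
    \<open>t\<close> avoids \<open>p\<close>, so compactness gives some bound \<open>k'\<close>
    depending on \<open>t\<close>; growth from \<open>q\<close> replaces it by one in terms of
    \<open>k\<close>, \<open>c'\<close> and \<open>L\<close>, which is the same for all
    \<open>t\<close>.\<close>
  have "supp_in m t" if t: "t \<in> {min p q..max p q}" for t
  proof (cases "t = p")
    case True
    then show ?thesis using n supp_in_mono unfolding m_def by simp
  next
    case False
    have sub: "u \<in> {min p q..max p q} \<and> u \<noteq> p" if "u \<in> {min q t..max q t}" for u
      using that t False by (auto simp: min_def max_def split: if_splits)
    have t0: "0 \<le> t" using t pq by auto
    obtain k' where k': "0 \<le> k'" "\<And>u. u \<in> {min q t..max q t} \<Longrightarrow> supp_in k' u"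
      by (rule locally_supported_Icc[of "min q t" "max q t"]) (use loc sub pq t0 in auto)
    have "supp_in (k + c' * L + L * (k + c' * L)) t"
      by (rule supp_in_growth[OF pq(2) t0 k' k]) (use L t c'_def in \<open>auto simp: min_def max_def split: if_splits\<close>)
    then show ?thesis unfolding m_def by (rule supp_in_mono) simp
  qed
  then show ?thesis
    by (intro supp_in_growth[OF pq, of m, OF _ _ n L c]) (use n in \<open>auto simp: m_def\<close>)
qed

text \<open>For each \<open>z\<close> outside the box the vanishing of a density at \<open>z\<close>
  is a closed condition on \<open>t\<close>. This is the closedness that the category argument
  requires.\<close>

lemma closed_supp_in: "closed {t. 0 \<le> t \<and> supp_in n t}"
proof -
  have "{t. 0 \<le> t \<and> supp_in n t} = {0..} \<inter> (\<Inter>\<alpha>\<in>{1..N}. \<Inter>z\<in>- phase_box n. {t \<in> {0..}. g \<alpha> t z = 0})"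
    unfolding supp_in_def atLeast_def by blast
  also have "closed \<dots>"
    by (intro closed_Int closed_atLeast closed_INT ballI continuous_closed_preimage_constant continuous_on_g
        continuous_intros) auto
  finally show ?thesis .
qed

lemma continuous_on_charge_in: "continuous_on {0..} (charge_in n)"
  unfolding charge_in_def
  by (intro continuous_intros integral_continuous_on_param, unfold case_prod_unfold,
      intro continuous_on_g continuous_intros) auto

text \<open>
  The definition of a solution bounds each support separately in time only. The bad times form a closed
  set; by Baire some portion of it has a common support bound, which spreads over the gaps of the
  portion from the nearest bad time.
\<close>

lemma locally_supported:
  assumes "0 \<le> t"
  shows "locally_supported t"
proof -
  define F where "F = {t. 0 \<le> t \<and> \<not> locally_supported t}"
  have "open {t. locally_supported t}"
    unfolding open_dist
  proof (intro ballI)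
    fix t assume "t \<in> {t. locally_supported t}"
    then obtain \<delta> n where \<delta>: "\<delta> > 0" and n: "\<forall>s\<ge>0. \<bar>s - t\<bar> < \<delta> \<longrightarrow> supp_in n s"
      unfolding locally_supported_def by blast
    have "locally_supported u" if "dist u t < \<delta> / 2" for u
      unfolding locally_supported_def
    proof (intro exI conjI allI impI)
      show "0 < \<delta> / 2" using \<delta> by simp
      fix s :: real assume s: "0 \<le> s" "\<bar>s - u\<bar> < \<delta> / 2"
      then have "\<bar>s - t\<bar> < \<delta>" using that unfolding dist_real_def by linarith
      then show "supp_in n s" using n s(1) by blast
    qed
    then show "\<exists>d>0. \<forall>u. dist u t < d \<longrightarrow> u \<in> {t. locally_supported t}"
      using \<delta> by (intro exI[of _ "\<delta> / 2"]) auto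
  qed
  then have "closed ({0..} \<inter> - {t. locally_supported t})" by (intro closed_Int) auto
  also have "{0..} \<inter> - {t. locally_supported t} = F" unfolding F_def by auto
  finally have closedF: "closed F" .
  have "F = {}"
  proof (rule ccontr)
    assume "F \<noteq> {}"
    \<comment> \<open>The times of \<open>F\<close> not covered by the bound \<open>n\<close>, an
      open subset of \<open>F\<close>. If every \<open>T n\<close> were dense in \<open>F\<close>,
      so would be their intersection; but it is empty, since each single time has some support
      bound.\<close>
    define T where "T n = F - {t. 0 \<le> t \<and> supp_in (real n) t}" for n :: nat
    have "\<exists>n. \<not> F \<subseteq> closure (T n)"
    proof (rule ccontr)
      assume "\<nexists>n. \<not> F \<subseteq> closure (T n)"
      then have "F \<subseteq> closure (\<Inter>(range T))"
        by (intro Baire closedF) (auto simp: T_def Diff_eq intro!: openin_open_Int closed_supp_in)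
      moreover have "\<Inter>(range T) = {}"
      proof -
        have "t \<notin> \<Inter>(range T)" for t
        proof
          assume t: "t \<in> \<Inter>(range T)"
          then have "0 \<le> t" by (auto simp: T_def F_def)
          then obtain k where "supp_in k t" using supp_in_ex by blast
          then have "supp_in (real (nat \<lceil>k\<rceil>)) t" by (rule supp_in_mono) linarith
          then show False using t \<open>0 \<le> t\<close> by (auto simp: T_def)
        qed
        then show ?thesis by blast
      qed
      ultimately show False using \<open>F \<noteq> {}\<close> by simp
    qed
    then obtain n t0 where t0: "t0 \<in> F" "t0 \<notin> closure (T n)" by blast
    then obtain \<delta> where \<delta>: "\<delta> > 0" "\<And>s. s \<in> T n \<Longrightarrow> \<not> dist s t0 < \<delta>"
      by (auto simp: closure_approachable)
    have supp_F: "supp_in (real n) s" if "s \<in> F" "\<bar>s - t0\<bar> < \<delta>" for s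
      using \<delta>(2)[of s] that by (auto simp: T_def dist_real_def F_def)
    have t00: "0 \<le> t0" using t0 by (simp add: F_def)
    define K where "K = {max 0 (t0 - \<delta>)..t0 + \<delta>}"
    \<comment> \<open>One constant \<open>c\<close> must serve all bad times near \<open>t0\<close>.
      The truncated charge is continuous on all of \<open>K\<close>, including times not known to
      satisfy \<open>supp_in n\<close>, and so is bounded there; it is used only at bad times
      \<open>p\<close>, where \<open>supp_in n p\<close> makes it the actual charge.\<close>
    have "continuous_on K (\<lambda>s. (\<Sum>\<alpha> = 1..N. \<bar>e \<alpha>\<bar>) * charge_in (real n) s)"
      by (intro continuous_intros continuous_on_subset[OF continuous_on_charge_in]) (auto simp: K_def)
    then have "bounded ((\<lambda>s. (\<Sum>\<alpha> = 1..N. \<bar>e \<alpha>\<bar>) * charge_in (real n) s) ` K)"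
      by (intro compact_imp_bounded compact_continuous_image) (auto simp: K_def)
    then obtain c where "\<forall>x\<in>(\<lambda>s. (\<Sum>\<alpha> = 1..N. \<bar>e \<alpha>\<bar>) * charge_in (real n) s) ` K. \<bar>x\<bar> \<le> c"
      unfolding bounded_iff real_norm_def by blast
    then have c: "(\<Sum>\<alpha> = 1..N. \<bar>e \<alpha>\<bar>) * charge_in (real n) s \<le> c" if "s \<in> K" for s
      using that by fastforce
    have "0 \<le> (\<Sum>\<alpha> = 1..N. \<bar>e \<alpha>\<bar>) * charge_in (real n) t0"
      using charge_in_nonneg[OF t00] by (intro mult_nonneg_nonneg sum_nonneg) auto
    then have c0: "0 \<le> c" using c[of t0] \<delta>(1) t00 by (auto simp: K_def)
    let ?m = "real n + c * \<delta> + \<delta> * (real n + c * \<delta>)"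
    have "supp_in ?m s" if s: "0 \<le> s" "\<bar>s - t0\<bar> < \<delta>" for s
    proof -
      have grow: "supp_in ?m s"
        if p: "p \<in> F" "min s t0 \<le> p" "p \<le> max s t0" and gap: "\<And>t. t \<in> {min p s..max p s} \<Longrightarrow> t \<noteq> p \<Longrightarrow> t \<notin> F"
        for p
      proof (rule supp_in_growth_open[where p = p])
        show p0: "0 \<le> p" using p by (simp add: F_def)
        have pt0: "\<bar>p - t0\<bar> < \<delta>" using p(2,3) s(2) by (auto simp: min_def max_def split: if_splits)
        show "supp_in (real n) p" by (rule supp_F[OF p(1) pt0])
        show "(\<Sum>\<alpha> = 1..N. \<bar>e \<alpha>\<bar>) * charge_in (real n) p \<le> c"
          by (rule c) (use p0 pt0 in \<open>auto simp: K_def\<close>)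
        show "\<bar>p - s\<bar> \<le> \<delta>" using p(2,3) s(2) by (auto simp: min_def max_def split: if_splits)
        show "locally_supported t" if "t \<in> {min p s..max p s}" "t \<noteq> p" for t
          using gap[OF that] that(1) p0 s(1) by (auto simp: F_def)
      qed (use s in auto)
      show ?thesis
      proof (cases "t0 \<le> s")
        case True
        \<comment> \<open>\<open>Sup ?P\<close> is the last bad time up to \<open>s\<close>. It lies
          between \<open>t0\<close> and \<open>s\<close>, hence within \<open>\<delta>\<close> of
          \<open>t0\<close>, and no bad time lies strictly between it and \<open>s\<close>; if
          \<open>s\<close> is bad it is \<open>s\<close> itself. The other case mirrors this with
          the first bad time from \<open>s\<close> on.\<close>
        let ?P = "F \<inter> {..s}"
        have bdd: "bdd_above ?P" by (auto intro: bdd_aboveI[of _ s])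
        have P: "Sup ?P \<in> ?P" using t0(1) True closedF bdd by (intro closed_contains_Sup) auto
        have up: "u \<le> Sup ?P" if "u \<in> ?P" for u by (rule cSup_upper[OF that bdd])
        show ?thesis
          by (rule grow[of "Sup ?P"]) (use P up[of t0] up t0(1) True in \<open>force+\<close>)
      next
        case False
        let ?P = "F \<inter> {s..}"
        have bdd: "bdd_below ?P" by (auto intro: bdd_belowI[of _ s])
        have P: "Inf ?P \<in> ?P" using t0(1) False closedF bdd by (intro closed_contains_Inf) auto
        have lo: "Inf ?P \<le> u" if "u \<in> ?P" for u by (rule cInf_lower[OF that bdd])
        show ?thesis
          by (rule grow[of "Inf ?P"]) (use P lo[of t0] lo t0(1) False in \<open>force+\<close>)
      qed
    qed
    then have "locally_supported t0" unfolding locally_supported_def using \<delta>(1) by blast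
    then show False using t0(1) by (simp add: F_def)
  qed
  then show ?thesis using assms by (auto simp: F_def)
qed

end

section \<open>The global bound with constants from the initial data\<close>

lemma vlasov_poisson_ex:
  assumes "vlasov_poisson_solution N e f0 f"
  obtains ft fx fv where "vlasov_poisson N e f0 f ft fx fv"
proof -
  define P where "P \<alpha> Ft Fx Fv \<longleftrightarrow>
    continuous_on ({0..} \<times> UNIV) (\<lambda>(t, z). f \<alpha> t (fst z) (snd z)) \<and>
    continuous_on ({0..} \<times> UNIV) (\<lambda>(t, z). Ft t z) \<and>
    continuous_on ({0..} \<times> UNIV) (\<lambda>(t, z). Fx t z) \<and>
    continuous_on ({0..} \<times> UNIV) (\<lambda>(t, z). Fv t z) \<and>
    (\<forall>t z. 0 \<le> t \<longrightarrow> ((\<lambda>s. f \<alpha> s (fst z) (snd z)) has_real_derivative Ft t z) (at t within {0..})) \<and>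
    (\<forall>t x v. 0 \<le> t \<longrightarrow> ((\<lambda>x. f \<alpha> t x v) has_real_derivative Fx t (x, v)) (at x)) \<and>
    (\<forall>t x v1 v2. 0 \<le> t \<longrightarrow> ((\<lambda>v1. f \<alpha> t x (v1, v2)) has_real_derivative Fv t (x, v1, v2)) (at v1))"
    for \<alpha> and Ft Fx Fv :: "real \<Rightarrow> real \<times> real \<times> real \<Rightarrow> real"
  have "\<exists>Ft Fx Fv. P \<alpha> Ft Fx Fv" if "\<alpha> \<in> {1..N}" for \<alpha>
  proof -
    have "C1_on ({0..} \<times> UNIV) (\<lambda>(t, x, v). f \<alpha> t x v)"
      using assms that unfolding vlasov_poisson_solution_def by blast
    then show ?thesis
      by (rule C1_on_strip_partials) (unfold P_def, blast)
  qed
  then obtain ft fx fv where P: "\<And>\<alpha>. \<alpha> \<in> {1..N} \<Longrightarrow> P \<alpha> (ft \<alpha>) (fx \<alpha>) (fv \<alpha>)"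
    by metis
  have "vlasov_poisson N e f0 f ft fx fv"
    by unfold_locales (use assms P in \<open>simp_all only: P_def\<close>)
  then show ?thesis by (rule that)
qed

context vlasov_poisson
begin

lemma initial: "\<alpha> \<in> {1..N} \<Longrightarrow> f \<alpha> 0 x v = f0 \<alpha> x v"
  using solution unfolding vlasov_poisson_solution_def by blast

text \<open>Local bounds on the compact interval \<open>{0..t}\<close> supply a box whose size
  depends on \<open>f\<close> and \<open>t\<close>; it disappears from the estimate, whose
  coefficients involve only the charges and \<open>f0\<close>. This is what allows one constant for
  all times and all solutions.\<close>

lemma velocity_growth:
  assumes n: "0 \<le> n"
    and init: "\<And>\<alpha> z. \<alpha> \<in> {1..N} \<Longrightarrow> f0 \<alpha> (fst z) (snd z) \<noteq> 0 \<Longrightarrow> z \<in> phase_box n"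
    and neutral: "(LINT x|lborel. LINT v|lborel. (\<Sum>\<alpha> = 1..N. e \<alpha> * f0 \<alpha> x v)) = 0"
    and M: "\<And>\<alpha>. M \<alpha> = integral (phase_box n) (\<lambda>z. f0 \<alpha> (fst z) (snd z))"
    and D: "D = (\<Sum>\<alpha> = 1..N. \<bar>e \<alpha>\<bar> * M \<alpha>)" and S: "S = (\<Sum>\<alpha> = 1..N. \<bar>e \<alpha>\<bar>)"
    and \<alpha>: "\<alpha> \<in> {1..N}" and t: "0 \<le> t" and f: "f \<alpha> t x (v1, v2) \<noteq> 0"
  shows "v1\<^sup>2 \<le> (n + 1)\<^sup>2 + 4 * (S * (2 * (n + 1) * D +
    (D / 2 + S * ((n + 1)\<^sup>2 / 2 * (\<Sum>\<alpha> = 1..N. M \<alpha>) + (n + 1) * D\<^sup>2)) * t))"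
proof -
  obtain k where k: "0 \<le> k" "\<And>s. s \<in> {0..t} \<Longrightarrow> supp_in k s"
    by (rule locally_supported_Icc[of 0 t]) (use t locally_supported in auto)
  define r where "r = max k n + 1"
  interpret vlasov_poisson_box N e 0 t r g ft fx fv
    by (rule box[where n = "max k n"]) (use t n k supp_in_mono[of k _ "max k n"] in \<open>auto simp: r_def\<close>)
  have s0: "supp_in n 0"
    unfolding supp_in_def using init initial by auto
  have nr: "n \<le> r" by (simp add: r_def)
  have mass: "mass \<alpha> 0 = M \<alpha>" if "\<alpha> \<in> {1..N}" for \<alpha>
    using integral_g_eq[OF s0 nr that] initial[OF that] by (simp add: mass_def M)
  have "rho N e f 0 = box_charge N e r g 0"
    using rho_eq[OF order_refl supp_in_mono[OF s0 nr]] by blast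
  then have "integral {-r..r} (box_charge N e r g 0) = integral (cbox (-r) r) (rho N e f 0)" by simp
  also have "\<dots> = (LINT x:UNIV|lborel. rho N e f 0 x)"
    using rho_zero[OF order_refl s0] continuous_on_rho[OF order_refl] nr
    by (intro set_integral_lborel_eq_integral_cbox[symmetric]) (auto intro: continuous_on_subset)
  also have "\<dots> = (LINT x|lborel. LINT v|lborel. (\<Sum>\<alpha> = 1..N. e \<alpha> * f0 \<alpha> x v))"
  proof -
    have "(\<Sum>\<alpha> = 1..N. e \<alpha> * f \<alpha> 0 x v) = (\<Sum>\<alpha> = 1..N. e \<alpha> * f0 \<alpha> x v)" for x v
      by (intro sum.cong) (simp_all add: initial)
    then show ?thesis by (simp add: set_lebesgue_integral_def rho_def)
  qed
  finally have neutral': "integral {-r..r} (box_charge N e r g 0) = 0" using neutral by simp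
  have "v1\<^sup>2 \<le> (n + 1)\<^sup>2 + 4 * (S * (2 * (n + 1) * D +
    (D / 2 + S * ((n + 1)\<^sup>2 / 2 * (\<Sum>\<alpha> = 1..N. M \<alpha>) + (n + 1) * D\<^sup>2)) * (t - 0)))"
  proof (rule velocity_growth[OF \<alpha>])
    \<comment> \<open>The closed box of size \<open>n\<close> gives weak inequalities, hence
      \<open>n + 1\<close> for the strict ones.\<close>
    show "\<bar>x\<bar> < n + 1 \<and> \<bar>v1\<bar> < n + 1 \<and> \<bar>v2\<bar> < n + 1"
      if "\<alpha> \<in> {1..N}" "g \<alpha> 0 (x, v1, v2) \<noteq> 0" for \<alpha> x v1 v2
      using supp_inD[OF s0 that(1), of x "(v1, v2)"] that(2) by auto
    show "D = total_charge 0" unfolding D total_charge_def by (intro sum.cong) (auto simp: mass)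
    show "(\<Sum>\<alpha> = 1..N. M \<alpha>) = (\<Sum>\<alpha> = 1..N. mass \<alpha> 0)" by (intro sum.cong) (auto simp: mass)
    show "integral {-r..r} (box_charge N e r g 0) = 0" by (rule neutral')
    show "g \<alpha> t (x, v1, v2) \<noteq> 0" using f by simp
  qed (use n t S in \<open>auto simp: r_def\<close>)
  then show ?thesis by simp
qed

end

theorem theorem1p6:
  fixes N :: nat
    and e :: "nat \<Rightarrow> real"
    and f0 :: "nat \<Rightarrow> real \<Rightarrow> real \<times> real \<Rightarrow> real"
  assumes "N \<ge> 1"
    and "\<And>\<alpha> x v. \<alpha> \<in> {1..N} \<Longrightarrow> f0 \<alpha> x v \<ge> 0"
    and "\<And>\<alpha>. \<alpha> \<in> {1..N} \<Longrightarrow> C1_on UNIV (\<lambda>(x, v). f0 \<alpha> x v)"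
    and "\<And>\<alpha>. \<alpha> \<in> {1..N} \<Longrightarrow> compactly_supported (\<lambda>(x, v). f0 \<alpha> x v)"
    and "(LINT x|lborel. LINT v|lborel. (\<Sum>\<alpha> = 1..N. e \<alpha> * f0 \<alpha> x v)) = 0"
  shows "\<exists>C>0. \<forall>f. vlasov_poisson_solution N e f0 f \<longrightarrow>
           (\<forall>t\<ge>0. Q1 N f t \<le> C * sqrt (1 + t))"
proof -
  have "bounded (\<Union>\<alpha>\<in>{1..N}. {z. f0 \<alpha> (fst z) (snd z) \<noteq> 0})"
  proof (intro bounded_UN ballI)
    fix \<alpha> assume "\<alpha> \<in> {1..N}"
    then have "bounded (closure {z. f0 \<alpha> (fst z) (snd z) \<noteq> 0})"
      using assms(4) unfolding compactly_supported_def by (simp add: case_prod_unfold compact_imp_bounded)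
    then show "bounded {z. f0 \<alpha> (fst z) (snd z) \<noteq> 0}" using closure_subset by (rule bounded_subset)
  qed auto
  then obtain k where k: "(\<Union>\<alpha>\<in>{1..N}. {z. f0 \<alpha> (fst z) (snd z) \<noteq> 0}) \<subseteq> phase_box k"
    by (rule bounded_subset_phase_box)
  \<comment> \<open>If all data vanish, \<open>k\<close> may be negative and its box empty, while
    later estimates need a nonnegative size.\<close>
  define n where "n = max 0 k"
  have n0: "0 \<le> n" by (simp add: n_def)
  have n: "z \<in> phase_box n" if "\<alpha> \<in> {1..N}" "f0 \<alpha> (fst z) (snd z) \<noteq> 0" for \<alpha> z
    using k phase_box_mono[of k n] that by (force simp: n_def)
  define M where "M \<alpha> = integral (phase_box n) (\<lambda>z. f0 \<alpha> (fst z) (snd z))" for \<alpha>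
  define D where "D = (\<Sum>\<alpha> = 1..N. \<bar>e \<alpha>\<bar> * M \<alpha>)"
  define S where "S = (\<Sum>\<alpha> = 1..N. \<bar>e \<alpha>\<bar>)"
  define J where "J = D / 2 + S * ((n + 1)\<^sup>2 / 2 * (\<Sum>\<alpha> = 1..N. M \<alpha>) + (n + 1) * D\<^sup>2)"
  \<comment> \<open>A non-integrable function has integral 0 by default, so the sign is settled
    without establishing integrability.\<close>
  have M0: "0 \<le> M \<alpha>" if "\<alpha> \<in> {1..N}" for \<alpha>
    unfolding M_def
    by (cases "(\<lambda>z. f0 \<alpha> (fst z) (snd z)) integrable_on phase_box n")
       (use assms(2) that in \<open>auto simp: not_integrable_integral intro: Henstock_Kurzweil_Integration.integral_nonneg\<close>)
  then have D0: "0 \<le> D" and S0: "0 \<le> S" and SM: "0 \<le> (\<Sum>\<alpha> = 1..N. M \<alpha>)"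
    unfolding D_def S_def by (auto intro!: sum_nonneg)
  then have J0: "0 \<le> J" using n0 unfolding J_def by (intro add_nonneg_nonneg mult_nonneg_nonneg) auto
  \<comment> \<open>Bounds \<open>v1\<^sup>2\<close> by \<open>C * (1 + t)\<close>, using
    \<open>1 \<le> 1 + t\<close> on the constant terms and \<open>t \<le> 1 + t\<close> on the
    linear one; the witness is \<open>sqrt C\<close>. It is fixed before any solution is considered,
    and is positive because \<open>(n + 1)\<^sup>2\<close> is.\<close>
  define C where "C = (n + 1)\<^sup>2 + 4 * (S * (2 * (n + 1) * D + J))"
  have nD: "0 \<le> 2 * (n + 1) * D" using n0 D0 by simp
  have "0 < C"
    unfolding C_def using n0 S0 nD J0 by (intro add_pos_nonneg mult_nonneg_nonneg) auto
  have "Q1 N f t \<le> sqrt C * sqrt (1 + t)" if sol: "vlasov_poisson_solution N e f0 f" and t: "0 \<le> t" for f t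
  proof -
    obtain ft fx fv where "vlasov_poisson N e f0 f ft fx fv"
      using vlasov_poisson_ex[OF sol] .
    then interpret vlasov_poisson N e f0 f ft fx fv .
    have "\<bar>v1\<bar> \<le> sqrt C * sqrt (1 + t)" if ne: "(\<Sum>\<alpha> = 1..N. f \<alpha> t x (v1, v2)) \<noteq> 0" for x v1 v2
    proof -
      obtain \<alpha> where \<alpha>: "\<alpha> \<in> {1..N}" "f \<alpha> t x (v1, v2) \<noteq> 0"
        using ne sum.not_neutral_contains_not_neutral by blast
      have "v1\<^sup>2 \<le> (n + 1)\<^sup>2 + 4 * (S * (2 * (n + 1) * D + J * t))"
        unfolding J_def by (rule velocity_growth[OF n0 n assms(5) M_def D_def S_def \<alpha>(1) t \<alpha>(2)])
      also have "\<dots> \<le> (n + 1)\<^sup>2 * (1 + t) + 4 * (S * ((2 * (n + 1) * D + J) * (1 + t)))"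
      proof (intro add_mono mult_left_mono)
        show "(n + 1)\<^sup>2 \<le> (n + 1)\<^sup>2 * (1 + t)" using t by (simp add: mult_le_cancel_left1)
        have "0 \<le> 2 * (n + 1) * D * t + J" using nD J0 t by simp
        then show "2 * (n + 1) * D + J * t \<le> (2 * (n + 1) * D + J) * (1 + t)"
          by (simp add: algebra_simps)
      qed (use S0 in auto)
      also have "\<dots> = C * (1 + t)" unfolding C_def by (simp add: algebra_simps)
      finally have "sqrt (v1\<^sup>2) \<le> sqrt (C * (1 + t))" by (rule real_sqrt_le_mono)
      then show ?thesis by (simp only: real_sqrt_abs real_sqrt_mult)
    qed
    then have "Sup (Q1_set N f t) \<le> sqrt C * sqrt (1 + t)" if "Q1_set N f t \<noteq> {}"
      using that by (intro cSup_least) (auto simp: Q1_set_def)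
    then show ?thesis
      using \<open>0 < C\<close> t by (auto simp: Q1_def)
  qed
  then show ?thesis
    using \<open>0 < C\<close> by (intro exI[of _ "sqrt C"]) auto
qed

end
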